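(* There are constants $c,C>0$ such that for all positive integers $n$, $$c\,n^2\le \mu_n\le C\,n^2,$$ where $\mu_n$ is the largest meander number $\mu(\sigma)$ among all cyclic permutations $\sigma$ of $[n]=\{0,1,\ldots,n-1\}$.
   Context: A cyclic permutation $\sigma$ of $[n]=\{0,1,\ldots,n-1\}$ is a permutation consisting of a single $n$-cycle; it is written in cycle notation $\sigma=(\sigma_0,\sigma_1,\ldots,\sigma_{n-1})$, a listing of all elements of $[n]$ understood up to cyclic rotation. Meander number. A set of pairs of elements of $[N]$ is non-crossing if it does not contain two pairs $\{a_1,b_1\},\{a_2,b_2\}$ with $a_1<a_2<b_1<b_2$. For $N$ even and positive, a cyclic permutation $\tau=(\tau_0,\ldots,\tau_{N-1})$ of $[N]$ is cyclic meandric if the two alternating matchings $\{\{\tau_0,\tau_1\},\{\tau_2,\tau_3\},\ldots,\{\tau_{N-2},\tau_{N-1}\}\}$ and $\{\{\tau_1,\tau_2\},\{\tau_3,\tau_4\},\ldots,\{\tau_{N-1},\tau_0\}\}$ are both non-crossing. For $S\subset[N]$, the first-return permutation of $\tau$ on $S$ is obtained by reading $\tau$ cyclically, deleting all letters outside $S$, and relabelling the elements of $S$ increasingly by $0,\ldots,|S|-1$; it is a cyclic permutation of $[|S|]$. The meander number $\mu(\sigma)$ of a cyclic permutation $\sigma$ of $[n]$ is the least even $N$ for which there is a cyclic meandric permutation of $[N]$ whose first-return permutation on some $n$-element subset of $[N]$ is $\sigma$. *)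

theory Defs
  imports Complex_Main "HOL-Combinatorics.Cycles" "HOL-Combinatorics.Orbits"
begin

definition cyclic_permutation :: "nat \<Rightarrow> (nat \<Rightarrow> nat) \<Rightarrow> bool" where
  "cyclic_permutation n \<sigma> \<longleftrightarrow> \<sigma> permutes {..<n} \<and> cyclic_on \<sigma> {..<n}"

text \<open>
  The cycle notation of a cyclic permutation is only determined up to rotation; we fix the
  listing that starts at 0. The notions below that are defined through this listing do not
  depend on the choice: see \<open>first_return_rotate\<close> and \<open>matching_rotate1\<close>.
\<close>

definition cycle_notation :: "nat \<Rightarrow> (nat \<Rightarrow> nat) \<Rightarrow> nat list" where
  "cycle_notation n \<sigma> = map (\<lambda>i. (\<sigma> ^^ i) 0) [0..<n]"

definition non_crossing :: "nat set set \<Rightarrow> bool" where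
  "non_crossing M \<longleftrightarrow>
     \<not> (\<exists>a\<^sub>1 b\<^sub>1 a\<^sub>2 b\<^sub>2. {a\<^sub>1, b\<^sub>1} \<in> M \<and> {a\<^sub>2, b\<^sub>2} \<in> M \<and> a\<^sub>1 < a\<^sub>2 \<and> a\<^sub>2 < b\<^sub>1 \<and> b\<^sub>1 < b\<^sub>2)"

definition even_matching :: "nat list \<Rightarrow> nat set set" where
  "even_matching xs = {{xs ! i, xs ! (Suc i mod length xs)} | i. i < length xs \<and> even i}"

definition odd_matching :: "nat list \<Rightarrow> nat set set" where
  "odd_matching xs = {{xs ! i, xs ! (Suc i mod length xs)} | i. i < length xs \<and> odd i}"

definition cyclic_meandric :: "nat \<Rightarrow> (nat \<Rightarrow> nat) \<Rightarrow> bool" where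
  "cyclic_meandric N \<tau> \<longleftrightarrow> even N \<and> 0 < N \<and> cyclic_permutation N \<tau> \<and>
     non_crossing (even_matching (cycle_notation N \<tau>)) \<and>
     non_crossing (odd_matching (cycle_notation N \<tau>))"

text \<open>The order isomorphism from a finite set \<open>S\<close> onto \<open>{..<card S}\<close>, evaluated at \<open>x \<in> S\<close>.\<close>

definition rank_in :: "nat set \<Rightarrow> nat \<Rightarrow> nat" where
  "rank_in S x = card {y \<in> S. y < x}"

definition first_return :: "nat \<Rightarrow> (nat \<Rightarrow> nat) \<Rightarrow> nat set \<Rightarrow> nat \<Rightarrow> nat" where
  "first_return N \<tau> S =
     cycle_of_list (map (rank_in S) (filter (\<lambda>x. x \<in> S) (cycle_notation N \<tau>)))"

definition meander_number :: "nat \<Rightarrow> (nat \<Rightarrow> nat) \<Rightarrow> nat" where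
  "meander_number n \<sigma> = (LEAST N. even N \<and>
     (\<exists>\<tau> S. cyclic_meandric N \<tau> \<and> S \<subseteq> {..<N} \<and> card S = n \<and> first_return N \<tau> S = \<sigma>))"

definition max_meander_number :: "nat \<Rightarrow> nat" where
  "max_meander_number n = Max {meander_number n \<sigma> | \<sigma>. cyclic_permutation n \<sigma>}"

lemma cycle_notation_props:
  assumes "cyclic_permutation n \<sigma>"
  shows "length (cycle_notation n \<sigma>) = n"
    and "distinct (cycle_notation n \<sigma>)"
    and "set (cycle_notation n \<sigma>) = {..<n}"
    and "cycle_of_list (cycle_notation n \<sigma>) = \<sigma>"
proof -
  have perm: "\<sigma> permutes {..<n}" and cyc: "cyclic_on \<sigma> {..<n}"
    using assms by (auto simp: cyclic_permutation_def)
  have pm: "permutation \<sigma>"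
    by (rule permutes_imp_permutation[OF finite_lessThan perm])
  have "0 < n"
    using cyc by (auto simp: cyclic_on_alldef)
  then have orb: "orbit \<sigma> 0 = {..<n}"
    using cyc by (simp add: orbit_cyclic_eq3)
  have supp: "set (support \<sigma> 0) = {..<n}"
    unfolding support_set[OF pm] orb[symmetric] orbit_altdef_permutation[OF pm] by auto
  have "least_power \<sigma> 0 = n"
    using distinct_card[OF cycle_of_permutation[OF pm, of 0]] unfolding supp by simp
  then have cn: "cycle_notation n \<sigma> = support \<sigma> 0"
    by (simp add: cycle_notation_def)
  show "length (cycle_notation n \<sigma>) = n"
    by (simp add: cycle_notation_def)
  show "distinct (cycle_notation n \<sigma>)"
    unfolding cn by (rule cycle_of_permutation[OF pm])
  show st: "set (cycle_notation n \<sigma>) = {..<n}"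
    unfolding cn by (rule supp)
  show "cycle_of_list (cycle_notation n \<sigma>) = \<sigma>"
  proof
    fix x
    show "cycle_of_list (cycle_notation n \<sigma>) x = \<sigma> x"
    proof (cases "x < n")
      case True
      then show ?thesis
        using cycle_restrict[OF pm, of x 0] supp cn by simp
    next
      case False
      then show ?thesis
        using id_outside_supp[of x "cycle_notation n \<sigma>"] st perm
        by (simp add: permutes_not_in)
    qed
  qed
qed

lemma cyclic_permutation_iff_cycle_of_list:
  assumes "0 < n"
  shows "cyclic_permutation n \<sigma> \<longleftrightarrow>
    (\<exists>xs. distinct xs \<and> set xs = {..<n} \<and> \<sigma> = cycle_of_list xs)"
proof
  assume "cyclic_permutation n \<sigma>"
  then show "\<exists>xs. distinct xs \<and> set xs = {..<n} \<and> \<sigma> = cycle_of_list xs"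
    using cycle_notation_props[of n \<sigma>] by (intro exI[of _ "cycle_notation n \<sigma>"]) simp
next
  assume "\<exists>xs. distinct xs \<and> set xs = {..<n} \<and> \<sigma> = cycle_of_list xs"
  then obtain xs where xs: "distinct xs" "set xs = {..<n}" "\<sigma> = cycle_of_list xs"
    by blast
  have perm: "\<sigma> permutes {..<n}"
    unfolding xs(3) xs(2)[symmetric] by (rule cycle_permutes)
  have pm: "permutation \<sigma>"
    by (rule permutes_imp_permutation[OF finite_lessThan perm])
  have ne: "xs \<noteq> []"
  proof
    assume "xs = []"
    then show False
      using xs(2) assms by (metis empty_iff lessThan_iff list.set(1))
  qed
  have hd: "hd xs \<in> {..<n}"
    unfolding xs(2)[symmetric] using ne by (rule hd_in_set)
  have "{..<n} \<subseteq> orbit \<sigma> (hd xs)"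
  proof
    fix x assume "x \<in> {..<n}"
    then obtain k where k: "k < length xs" "xs ! k = x"
      unfolding xs(2)[symmetric] in_set_conv_nth by blast
    have "map (\<sigma> ^^ k) xs ! 0 = rotate k xs ! 0"
      using cyclic_rotation[OF xs(1)] xs(3) by simp
    then have "(\<sigma> ^^ k) (hd xs) = x"
      using k ne by (simp add: nth_rotate hd_conv_nth)
    then show "x \<in> orbit \<sigma> (hd xs)"
      unfolding orbit_altdef_permutation[OF pm] by blast
  qed
  moreover have "orbit \<sigma> (hd xs) \<subseteq> {..<n}"
    by (rule permutes_orbit_subset[OF perm hd])
  ultimately show "cyclic_permutation n \<sigma>"
    using perm hd unfolding cyclic_permutation_def cyclic_on_def by (metis subset_antisym)
qed

lemma rank_in_bij_betw:
  assumes "finite S"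
  shows "bij_betw (rank_in S) S {..<card S}"
proof -
  have mono: "rank_in S x < rank_in S y" if "x \<in> S" "x < y" for x y
    unfolding rank_in_def using that assms by (intro psubset_card_mono) auto
  have inj: "inj_on (rank_in S) S"
    by (rule inj_onI) (metis mono less_irrefl linorder_neqE_nat)
  have "rank_in S x < card S" if "x \<in> S" for x
    unfolding rank_in_def using that assms by (intro psubset_card_mono) auto
  then have "rank_in S ` S \<subseteq> {..<card S}"
    by auto
  then have "rank_in S ` S = {..<card S}"
    by (intro card_subset_eq) (auto simp: card_image[OF inj])
  with inj show ?thesis
    by (simp add: bij_betw_def)
qed

lemma first_return_listing_props:
  assumes "cyclic_permutation N \<tau>" "S \<subseteq> {..<N}"
  defines "ys \<equiv> map (rank_in S) (filter (\<lambda>x. x \<in> S) (cycle_notation N \<tau>))"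
  shows "distinct ys" and "set ys = {..<card S}"
proof -
  have fin: "finite S"
    using assms(2) finite_subset by blast
  have st: "set (filter (\<lambda>x. x \<in> S) (cycle_notation N \<tau>)) = S"
    using cycle_notation_props(3)[OF assms(1)] assms(2) by auto
  show "distinct ys"
    using cycle_notation_props(2)[OF assms(1)] rank_in_bij_betw[OF fin] st
    unfolding ys_def distinct_map bij_betw_def by simp
  show "set ys = {..<card S}"
    using rank_in_bij_betw[OF fin] st unfolding ys_def bij_betw_def
    by (metis set_map)
qed

lemma cyclic_permutation_first_return:
  assumes "cyclic_permutation N \<tau>" "S \<subseteq> {..<N}" "S \<noteq> {}"
  shows "cyclic_permutation (card S) (first_return N \<tau> S)"
proof -
  have "0 < card S"
    using assms(2,3) by (meson card_gt_0_iff finite_lessThan finite_subset)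
  then show ?thesis
    using first_return_listing_props[OF assms(1,2)]
    unfolding cyclic_permutation_iff_cycle_of_list[OF \<open>0 < card S\<close>] first_return_def by blast
qed

lemma filter_rotate_ex: "\<exists>k. filter P (rotate m xs) = rotate k (filter P xs)"
proof -
  let ?m = "m mod length xs"
  have "filter P (rotate m xs) = filter P (drop ?m xs) @ filter P (take ?m xs)"
    by (simp add: rotate_drop_take)
  also have "\<dots> = rotate (length (filter P (take ?m xs)))
      (filter P (take ?m xs) @ filter P (drop ?m xs))"
    by (simp add: rotate_append)
  also have "filter P (take ?m xs) @ filter P (drop ?m xs) = filter P xs"
    by (metis append_take_drop_id filter_append)
  finally show ?thesis
    by blast
qed

lemma first_return_rotate:
  assumes "cyclic_permutation N \<tau>" "S \<subseteq> {..<N}"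
  shows "cycle_of_list (map (rank_in S) (filter (\<lambda>x. x \<in> S) (rotate m (cycle_notation N \<tau>))))
    = first_return N \<tau> S"
proof -
  obtain k where k: "filter (\<lambda>x. x \<in> S) (rotate m (cycle_notation N \<tau>)) =
      rotate k (filter (\<lambda>x. x \<in> S) (cycle_notation N \<tau>))"
    using filter_rotate_ex by blast
  show ?thesis
    unfolding k first_return_def rotate_map[symmetric]
    using cycle_of_list_rotate_independent[OF first_return_listing_props(1)[OF assms]] by simp
qed

lemma matching_rotate1:
  assumes "even (length xs)"
  shows "even_matching (rotate1 xs) = odd_matching xs"
    and "odd_matching (rotate1 xs) = even_matching xs"
proof -
  let ?N = "length xs"
  have nth: "rotate1 xs ! i = xs ! (Suc i mod ?N)" if "i < ?N" for i
    using that by (simp add: nth_rotate1)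
  have *: "{{rotate1 xs ! i, rotate1 xs ! (Suc i mod ?N)} | i. i < ?N \<and> (even i \<longleftrightarrow> b)} =
      {{xs ! i, xs ! (Suc i mod ?N)} | i. i < ?N \<and> (even i \<longleftrightarrow> \<not> b)}" (is "?L = ?R") for b
  proof (intro equalityI subsetI)
    fix p assume "p \<in> ?L"
    then obtain i where i: "i < ?N" "even i \<longleftrightarrow> b"
      "p = {rotate1 xs ! i, rotate1 xs ! (Suc i mod ?N)}"
      by blast
    have "Suc i mod ?N < ?N"
      using i(1) by (intro mod_less_divisor) linarith
    moreover have "even (Suc i mod ?N) \<longleftrightarrow> \<not> b"
      using i(2) assms by (simp add: dvd_mod_iff)
    moreover have "p = {xs ! (Suc i mod ?N), xs ! (Suc (Suc i mod ?N) mod ?N)}"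
      using i calculation(1) by (simp add: nth)
    ultimately show "p \<in> ?R"
      by blast
  next
    fix p assume "p \<in> ?R"
    then obtain j where j: "j < ?N" "even j \<longleftrightarrow> \<not> b" "p = {xs ! j, xs ! (Suc j mod ?N)}"
      by blast
    define i where "i = (if j = 0 then ?N - 1 else j - 1)"
    have i: "i < ?N" "Suc i mod ?N = j" "even i \<longleftrightarrow> b"
      using j assms by (auto simp: i_def)
    have "p = {rotate1 xs ! i, rotate1 xs ! (Suc i mod ?N)}"
      using i(1,2) j(1,3) by (simp add: nth)
    with i show "p \<in> ?L"
      by blast
  qed
  show "even_matching (rotate1 xs) = odd_matching xs"
    using *[of True] by (simp add: even_matching_def odd_matching_def)
  show "odd_matching (rotate1 xs) = even_matching xs"
    using *[of False] by (simp add: even_matching_def odd_matching_def)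
qed

lemma max_meander_number_wf:
  assumes "0 < n"
  shows "finite {meander_number n \<sigma> | \<sigma>. cyclic_permutation n \<sigma>}"
    and "{meander_number n \<sigma> | \<sigma>. cyclic_permutation n \<sigma>} \<noteq> {}"
proof -
  have "finite {\<sigma>. cyclic_permutation n \<sigma>}"
    by (rule finite_subset[OF _ finite_permutations[of "{..<n}"]])
      (auto simp: cyclic_permutation_def)
  then show "finite {meander_number n \<sigma> | \<sigma>. cyclic_permutation n \<sigma>}"
    by simp
  have "cyclic_permutation n (cycle_of_list [0..<n])"
    unfolding cyclic_permutation_iff_cycle_of_list[OF assms]
    by (rule exI[of _ "[0..<n]"]) auto
  then show "{meander_number n \<sigma> | \<sigma>. cyclic_permutation n \<sigma>} \<noteq> {}"
    by blast
qed

end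

(*
  Lower bound: cut the meander by a planar separator. The line together with the closed curve is
  a planar graph drawn in two pages, and for such drawings a separator theorem has a short mod 2
  proof: a closed walk leaves every vertex off the walk on one of two sides, given by the parity
  of its arcs passing over that vertex. With N crossings this yields a balanced bipartition of the
  marked points that changes only O(sqrt N) times along the line and along the curve. Counting
  orderings by their number of changes shows that some cyclic permutation admits only balanced
  bipartitions with a linear number of changes, so sqrt N is at least linear in n.

  Upper bound: run the line through an m x m grid column by column and the curve row by row, both
  in boustrophedon order. For even m this is a closed meander with m^2 crossings, and for n <= m
  it contains every cyclic permutation of n letters: mark the crossing of the j-th row with
  the column of the j-th letter.
*)
theory Submission
  imports Defs "HOL-Combinatorics.Multiset_Permutations"
begin

section \<open>Changes along lists\<close>

fun changes :: "'a list \<Rightarrow> nat" where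
  "changes (x # y # xs) = of_bool (x \<noteq> y) + changes (y # xs)"
| "changes _ = 0"

lemma changes_Cons: "changes (x # xs) = (if xs = [] then 0 else of_bool (x \<noteq> hd xs) + changes xs)"
  by (cases xs) auto

lemma changes_le_Cons: "changes xs \<le> changes (x # xs)"
  by (simp add: changes_Cons)

text \<open>Triangle inequality for the discrete metric; it is the reason why deleting letters never
  adds changes.\<close>

lemma changes_skip: "changes (x # zs) \<le> changes (x # y # zs)"
  by (cases zs) auto

lemma changes_filter_aux: "changes (a # map f (filter P xs)) \<le> changes (a # map f xs)"
proof (induction xs arbitrary: a)
  case (Cons x xs)
  show ?case
  proof (cases "P x")
    case False
    have "changes (a # map f (filter P xs)) \<le> changes (a # map f xs)"
      by (rule Cons.IH)
    also have "\<dots> \<le> changes (a # f x # map f xs)"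
      by (rule changes_skip)
    finally show ?thesis
      using False by simp
  qed (use Cons.IH in simp)
qed simp

lemma changes_filter: "changes (map f (filter P xs)) \<le> changes (map f xs)"
proof (induction xs)
  case (Cons x xs)
  show ?case
    using changes_filter_aux[of "f x" f P xs] Cons.IH changes_le_Cons[of "map f xs" "f x"]
    by (cases "P x") auto
qed simp

lemma changes_append_le: "changes (xs @ ys) \<le> changes xs + changes ys + 1"
  by (induction xs) (auto simp: changes_Cons)

lemma changes_append_ge: "changes xs + changes ys \<le> changes (xs @ ys)"
  by (induction xs) (auto simp: changes_Cons)

text \<open>Both lists consist of the same two blocks in opposite order, so only the change at the
  junction can be lost.\<close>

lemma changes_rotate: "changes (map f xs) \<le> changes (map f (rotate k xs)) + 1"
proof -
  let ?k = "k mod length xs"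
  have "changes (map f xs) = changes (map f (take ?k xs) @ map f (drop ?k xs))"
    by (metis append_take_drop_id map_append)
  also have "\<dots> \<le> changes (map f (drop ?k xs)) + changes (map f (take ?k xs)) + 1"
    using changes_append_le by (metis add.commute)
  also have "\<dots> \<le> changes (map f (drop ?k xs) @ map f (take ?k xs)) + 1"
    using changes_append_ge by simp
  finally show ?thesis
    by (simp add: rotate_drop_take)
qed

text \<open>Each change is charged to an adjacent entry in \<open>X\<close>, and an entry has at
  most two neighbours.\<close>

lemma changes_le_touching:
  assumes "\<And>i. Suc i < length xs \<Longrightarrow> f (xs ! i) \<noteq> f (xs ! Suc i) \<Longrightarrow> xs ! i \<in> X \<or> xs ! Suc i \<in> X"
    and "distinct xs" "finite X"
  shows "changes (map f xs) \<le> 2 * card X"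
proof -
  \<comment> \<open>Strengthened for the induction: a head in \<open>X\<close> keeps one of its two
    charges for the pair it forms with the next entry put in front.\<close>
  have "changes (map f xs) + of_bool (xs \<noteq> [] \<and> hd xs \<in> X) \<le> 2 * length (filter (\<lambda>x. x \<in> X) xs)"
    using assms(1)
  proof (induction xs)
    case (Cons x xs)
    have IH: "changes (map f xs) + of_bool (xs \<noteq> [] \<and> hd xs \<in> X) \<le> 2 * length (filter (\<lambda>x. x \<in> X) xs)"
    proof (rule Cons.IH)
      fix i assume "Suc i < length xs" "f (xs ! i) \<noteq> f (xs ! Suc i)"
      then show "xs ! i \<in> X \<or> xs ! Suc i \<in> X"
        using Cons.prems[of "Suc i"] by simp
    qed
    show ?case
    proof (cases xs)
      case (Cons y ys)
      then show ?thesis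
        using IH Cons.prems[of 0] by auto
    qed simp
  qed simp
  moreover have "length (filter (\<lambda>x. x \<in> X) xs) = card (set (filter (\<lambda>x. x \<in> X) xs))"
    using assms(2) by (metis distinct_card distinct_filter)
  moreover have "card (set (filter (\<lambda>x. x \<in> X) xs)) \<le> card X"
    using assms(3) by (intro card_mono) auto
  ultimately show ?thesis
    by linarith
qed

section \<open>Listings of a cycle up to rotation\<close>

lemma nth_eq_funpow_cycle_of_list:
  assumes "distinct xs" "i < length xs"
  shows "xs ! i = (cycle_of_list xs ^^ i) (xs ! 0)"
proof -
  have "map (cycle_of_list xs ^^ i) xs ! 0 = rotate i xs ! 0"
    using cyclic_rotation[OF assms(1), of i] by simp
  moreover have "map (cycle_of_list xs ^^ i) xs ! 0 = (cycle_of_list xs ^^ i) (xs ! 0)"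
    using assms(2) by (intro nth_map) auto
  moreover have "rotate i xs ! 0 = xs ! i"
    using assms(2) by (subst nth_rotate) auto
  ultimately show ?thesis
    by simp
qed

text \<open>Iterating the cycle recovers a listing from its first entry, so rotating
  \<open>xs\<close> until it begins with \<open>ys ! 0\<close> gives \<open>ys\<close>.\<close>

lemma cycle_of_list_eq_imp_rotate:
  assumes "distinct xs" "distinct ys" "set xs = set ys" "cycle_of_list xs = cycle_of_list ys"
  shows "\<exists>k. ys = rotate k xs"
proof (cases "ys = []")
  case True
  then show ?thesis using assms by auto
next
  case False
  have len: "length ys = length xs"
    using assms distinct_card by metis
  obtain k where k: "k < length xs" "xs ! k = ys ! 0"
    using False assms(3) by (metis in_set_conv_nth length_greater_0_conv nth_mem)
  have "ys ! i = rotate k xs ! i" if "i < length ys" for i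
  proof -
    have "rotate k xs ! i = (cycle_of_list (rotate k xs) ^^ i) (rotate k xs ! 0)"
      using assms(1) that len by (intro nth_eq_funpow_cycle_of_list) auto
    also have "cycle_of_list (rotate k xs) = cycle_of_list ys"
      using cycle_of_list_rotate_independent[OF assms(1)] assms(4) by metis
    also have "rotate k xs ! 0 = ys ! 0"
      using k by (subst nth_rotate) auto
    finally show ?thesis
      using nth_eq_funpow_cycle_of_list[OF assms(2) that] by simp
  qed
  then show ?thesis
    using len by (intro exI[of _ k] nth_equalityI) auto
qed

lemma cycle_notation_cycle_of_list:
  assumes "distinct xs" "length xs = n" "0 < n" "xs ! 0 = 0"
  shows "cycle_notation n (cycle_of_list xs) = xs"
proof (rule nth_equalityI)
  fix i assume "i < length (cycle_notation n (cycle_of_list xs))"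
  then show "cycle_notation n (cycle_of_list xs) ! i = xs ! i"
    using nth_eq_funpow_cycle_of_list[OF assms(1), of i] assms(2,4)
    by (simp add: cycle_notation_def)
qed (use assms in \<open>simp add: cycle_notation_def\<close>)

section \<open>Separators of two-page graphs\<close>

text \<open>As an exclusive or this is symmetric in \<open>a\<close> and \<open>b\<close> and
  additive mod 2: \<open>between a b\<close> is the sum of \<open>between a m\<close> and
  \<open>between m b\<close> for every \<open>m\<close>.\<close>

definition between :: "nat \<Rightarrow> nat \<Rightarrow> nat \<Rightarrow> bool" where
  "between a b x \<longleftrightarrow> (x < a) \<noteq> (x < b)"

text \<open>An arc with exactly one end below another arc of the same page would cross it; arcs with
  a common end are excluded by the last two hypotheses.\<close>

lemma between_cong:
  assumes "non_crossing M" "{a, b} \<in> M" "{x, y} \<in> M" "x \<notin> {a, b}" "y \<notin> {a, b}"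
  shows "between a b x = between a b y"
proof (rule ccontr)
  assume ne: "\<not> ?thesis"
  have nc: "\<And>a b x y. {a, b} \<in> M \<Longrightarrow> {x, y} \<in> M \<Longrightarrow> a < x \<Longrightarrow> x < b \<Longrightarrow> b < y \<Longrightarrow> False"
    using assms(1) unfolding non_crossing_def by blast
  have main: False if "{p, q} \<in> M" "{u, v} \<in> M" "p < u" "u < q" "v < p \<or> q < v" for p q u v
    using that nc[of p q u v] nc[of v u p q] by (auto simp: insert_commute)
  consider "between a b x" "\<not> between a b y" | "between a b y" "\<not> between a b x"
    using ne by blast
  then show False
  proof cases
    case 1
    then show False
      using main[of a b x y] main[of b a x y] assms(2-5)
      by (cases "a < b") (auto simp: between_def insert_commute)
  next
    case 2
    then show False
      using main[of a b y x] main[of b a y x] assms(2-5)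
      by (cases "a < b") (auto simp: between_def insert_commute)
  qed
qed

lemma between_Suc: "x \<noteq> a \<Longrightarrow> x \<noteq> b \<Longrightarrow> Suc x \<noteq> a \<Longrightarrow> Suc x \<noteq> b \<Longrightarrow> between a b (Suc x) = between a b x"
  unfolding between_def by auto

lemma between_adjacent: "x \<noteq> a \<Longrightarrow> x \<noteq> b \<Longrightarrow> b = Suc a \<or> a = Suc b \<Longrightarrow> \<not> between a b x"
  unfolding between_def by auto

section \<open>Geodesics, chords and sides of closed walks in a two-page graph\<close>

locale two_page =
  fixes N :: nat and U D :: "nat set set"
  assumes N_pos: "0 < N"
    and U_less: "{x, y} \<in> U \<Longrightarrow> x < N \<and> y < N"
    and D_less: "{x, y} \<in> D \<Longrightarrow> x < N \<and> y < N"
    and U_nc: "non_crossing U"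
    and D_nc: "non_crossing D"
begin

definition edges :: "(nat \<times> nat) set" where
  "edges = {(x, y). x < N \<and> y < N \<and> (y = Suc x \<or> x = Suc y \<or> {x, y} \<in> U \<or> {x, y} \<in> D)}"

text \<open>The graph distance from \<open>0\<close>; it is finite for every \<open>x < N\<close>
  because the line connects all vertices.\<close>

definition level :: "nat \<Rightarrow> nat" where
  "level x = (LEAST k. (0, x) \<in> edges ^^ k)"

definition separates :: "nat set \<Rightarrow> (nat \<Rightarrow> bool) \<Rightarrow> bool" where
  "separates X f \<longleftrightarrow> (\<forall>(x, y) \<in> edges. x \<notin> X \<longrightarrow> y \<notin> X \<longrightarrow> f x = f y)"

lemma edges_sym: "(x, y) \<in> edges \<Longrightarrow> (y, x) \<in> edges"
  unfolding edges_def by (auto simp: insert_commute)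

lemma reachable: "x < N \<Longrightarrow> (0, x) \<in> edges ^^ x"
proof (induction x)
  case (Suc x)
  then have "(0, x) \<in> edges ^^ x" "(x, Suc x) \<in> edges"
    by (auto simp: edges_def)
  then show ?case
    by auto
qed simp

lemma level_reach: "x < N \<Longrightarrow> (0, x) \<in> edges ^^ level x"
  unfolding level_def using LeastI[of "\<lambda>k. (0, x) \<in> edges ^^ k", OF reachable] .

lemma level_le: "(0, x) \<in> edges ^^ k \<Longrightarrow> level x \<le> k"
  unfolding level_def by (rule Least_le)

lemma level_edge:
  assumes "(x, y) \<in> edges"
  shows "level y \<le> Suc (level x)"
proof -
  have "(0, x) \<in> edges ^^ level x"
    using assms by (intro level_reach) (auto simp: edges_def)
  then show ?thesis
    using assms by (intro level_le) auto
qed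

lemma level_parent:
  assumes "x < N" "level x = Suc k"
  shows "\<exists>p. (p, x) \<in> edges \<and> level p = k"
proof -
  have "(0, x) \<in> edges ^^ Suc k"
    using level_reach[OF assms(1)] assms(2) by simp
  then obtain p where p: "(0, p) \<in> edges ^^ k" "(p, x) \<in> edges"
    by auto
  then have "level p \<le> k" "Suc k \<le> Suc (level p)"
    using level_le[OF p(1)] level_edge[OF p(2)] assms(2) by auto
  then show ?thesis
    using p(2) by auto
qed

lemma level_0: "x < N \<Longrightarrow> level x = 0 \<Longrightarrow> x = 0"
  using level_reach by fastforce

text \<open>
  \<open>P\<close> is a geodesic from \<open>0\<close> to \<open>a\<close>, and \<open>g x\<close> is the parity of the number of its upper arcs
  passing over \<open>x\<close>. All arcs of \<open>P\<close> passing over or under \<open>x\<close> have together the parity of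
  \<open>x < a\<close>, so \<open>g x \<noteq> (x < a)\<close> is the parity for the lower arcs.
\<close>

definition parity_path :: "nat \<Rightarrow> nat set \<Rightarrow> (nat \<Rightarrow> bool) \<Rightarrow> bool" where
  "parity_path a P g \<longleftrightarrow> 0 \<in> P \<and> a \<in> P \<and> P \<subseteq> {..<N} \<and> inj_on level P \<and> level ` P = {..level a} \<and>
     (\<forall>x y. x \<notin> P \<longrightarrow> y \<notin> P \<longrightarrow> {x, y} \<in> U \<longrightarrow> g x = g y) \<and>
     (\<forall>x. x \<notin> P \<longrightarrow> Suc x \<notin> P \<longrightarrow> g x = g (Suc x)) \<and>
     (\<forall>x y. x \<notin> P \<longrightarrow> y \<notin> P \<longrightarrow> {x, y} \<in> D \<longrightarrow> (g x \<noteq> (x < a)) = (g y \<noteq> (y < a)))"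

text \<open>Induction along a geodesic. Its last edge \<open>{p, a}\<close> adds
  \<open>between p a\<close> to one of the two parities: to \<open>g\<close> for an upper arc,
  otherwise to the lower parity, by replacing \<open>x < p\<close> with \<open>x < a\<close>. Arcs
  of the same page that avoid the path do not cross the new edge, and a segment of the line passes
  over no vertex.\<close>

lemma ex_parity_path: "a < N \<Longrightarrow> \<exists>P g. parity_path a P g"
proof (induction "level a" arbitrary: a)
  case 0
  then have "a = 0" "level 0 = 0"
    using level_0[of a] by auto
  then show ?case
    using N_pos unfolding parity_path_def
    by (intro exI[of _ "{0}"] exI[of _ "\<lambda>_. False"]) auto
next
  case (Suc k)
  obtain p where p: "(p, a) \<in> edges" "level p = k"
    using level_parent[of a k] Suc by metis
  then have "p < N" "p \<noteq> a"
    using Suc.hyps(2) by (auto simp: edges_def)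
  then obtain P g where Pg: "parity_path p P g"
    using Suc.hyps(1)[of p] p(2) by blast
  have U: "\<And>x y. x \<notin> P \<Longrightarrow> y \<notin> P \<Longrightarrow> {x, y} \<in> U \<Longrightarrow> g x = g y"
    and L: "\<And>x. x \<notin> P \<Longrightarrow> Suc x \<notin> P \<Longrightarrow> g x = g (Suc x)"
    and D: "\<And>x y. x \<notin> P \<Longrightarrow> y \<notin> P \<Longrightarrow> {x, y} \<in> D \<Longrightarrow> (g x \<noteq> (x < p)) = (g y \<noteq> (y < p))"
    and P: "0 \<in> P" "p \<in> P" "P \<subseteq> {..<N}" "inj_on level P" "level ` P = {..k}"
    using Pg p(2) unfolding parity_path_def by blast+
  let ?P = "insert a P" and ?g = "\<lambda>x. g x \<noteq> ({p, a} \<in> U \<and> between p a x)"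
  have "a \<notin> P"
    using P(5) Suc.hyps(2) by (metis atMost_iff imageI not_less_eq_eq order_refl)
  have nP: "x \<noteq> p" "x \<noteq> a" if "x \<notin> ?P" for x
    using that P by auto
  have im: "level ` ?P = {..level a}"
    using P(5) Suc.hyps(2) by (auto simp: atMost_Suc)
  have inj: "inj_on level ?P"
    using P(4,5) Suc.hyps(2) \<open>a \<notin> P\<close> by (simp add: image_iff)
  have U': "?g x = ?g y" if xy: "x \<notin> ?P" "y \<notin> ?P" "{x, y} \<in> U" for x y
  proof -
    have "g x = g y" "{p, a} \<in> U \<Longrightarrow> between p a x = between p a y"
      using U[of x y] between_cong[OF U_nc, of p a x y] xy nP[of x] nP[of y] by blast+
    then show ?thesis
      by argo
  qed
  have L': "?g x = ?g (Suc x)" if x: "x \<notin> ?P" "Suc x \<notin> ?P" for x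
  proof -
    have "g x = g (Suc x)" "between p a (Suc x) = between p a x"
      using L[of x] between_Suc[of x p a] x nP[of x] nP[of "Suc x"] by blast+
    then show ?thesis
      by argo
  qed
  have D': "(?g x \<noteq> (x < a)) = (?g y \<noteq> (y < a))" if xy: "x \<notin> ?P" "y \<notin> ?P" "{x, y} \<in> D" for x y
  proof -
    have g: "(g x \<noteq> (x < p)) = (g y \<noteq> (y < p))"
      using D[of x y] xy by blast
    \<comment> \<open>For \<open>{p, a}\<close> in \<open>U\<close>, both \<open>g\<close> and the
      comparison with the endpoint flip at the same vertices, so the lower parity is unchanged; only
      the opposite case needs an argument.\<close>
    have "between p a x = between p a y" if "{p, a} \<notin> U"
    proof (cases "{p, a} \<in> D")
      case True
      then show ?thesis
        using between_cong[OF D_nc True xy(3)] nP[of x] nP[of y] xy by blast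
    next
      case False
      then have "a = Suc p \<or> p = Suc a"
        using p(1) that unfolding edges_def by auto
      then show ?thesis
        using between_adjacent[of x p a] between_adjacent[of y p a] nP[of x] nP[of y] xy by blast
    qed
    then show ?thesis
      using g unfolding between_def by argo
  qed
  have "parity_path a ?P ?g"
    unfolding parity_path_def
  proof (intro conjI allI impI)
    show "0 \<in> ?P" "a \<in> ?P" "?P \<subseteq> {..<N}"
      using P(1,3) Suc.prems by auto
  qed (fact im inj | rule U' L' D'; assumption)+
  then show ?case
    by blast
qed

text \<open>One geodesic and one parity function are fixed per vertex, so that the contributions of
  a middle vertex cancel when closed walks are added.\<close>

definition path_set :: "nat \<Rightarrow> nat set" where
  "path_set a = (SOME P. \<exists>g. parity_path a P g)"

definition path_parity :: "nat \<Rightarrow> nat \<Rightarrow> bool" where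
  "path_parity a = (SOME g. parity_path a (path_set a) g)"

lemma parity_path: "a < N \<Longrightarrow> parity_path a (path_set a) (path_parity a)"
  unfolding path_parity_def path_set_def
  using someI_ex[OF ex_parity_path] by (rule someI_ex)

text \<open>Expresses that an arc from \<open>a\<close> to \<open>b\<close> could be drawn in the
  page \<open>M\<close> without crossing its arcs; it need not belong to \<open>M\<close>.\<close>

definition chord :: "nat set set \<Rightarrow> nat \<Rightarrow> nat \<Rightarrow> bool" where
  "chord M a b \<longleftrightarrow> (\<forall>x y. {x, y} \<in> M \<longrightarrow> x \<notin> {a, b} \<longrightarrow> y \<notin> {a, b} \<longrightarrow> between a b x = between a b y)"

text \<open>Side of \<open>x\<close> with respect to the closed walk along the geodesic from
  \<open>0\<close> to \<open>a\<close>, a chord to \<open>b\<close> and the geodesic back. Only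
  upper arcs are counted, so a chord drawn below the line contributes nothing, while one drawn above
  it adds \<open>between a b\<close> in \<open>upper_side\<close>.\<close>

definition lower_side :: "nat \<Rightarrow> nat \<Rightarrow> nat \<Rightarrow> bool" where
  "lower_side a b x \<longleftrightarrow> path_parity a x \<noteq> path_parity b x"

definition upper_side :: "nat \<Rightarrow> nat \<Rightarrow> nat \<Rightarrow> bool" where
  "upper_side a b x \<longleftrightarrow> lower_side a b x \<noteq> between a b x"

lemma separatesI:
  assumes "\<And>x y. x \<notin> X \<Longrightarrow> y \<notin> X \<Longrightarrow> {x, y} \<in> U \<Longrightarrow> f x = f y"
    and "\<And>x y. x \<notin> X \<Longrightarrow> y \<notin> X \<Longrightarrow> {x, y} \<in> D \<Longrightarrow> f x = f y"
    and "\<And>x. x \<notin> X \<Longrightarrow> Suc x \<notin> X \<Longrightarrow> f x = f (Suc x)"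
  shows "separates X f"
  unfolding separates_def edges_def using assms by fastforce

lemma path_parity_simps:
  assumes "a < N" "x \<notin> path_set a" "y \<notin> path_set a"
  shows "{x, y} \<in> U \<Longrightarrow> path_parity a x = path_parity a y"
    and "{x, y} \<in> D \<Longrightarrow> (path_parity a x \<noteq> (x < a)) = (path_parity a y \<noteq> (y < a))"
    and "y = Suc x \<Longrightarrow> path_parity a x = path_parity a y"
  using parity_path[OF assms(1)] assms(2,3) unfolding parity_path_def by blast+

lemma end_in_path_set: "a < N \<Longrightarrow> a \<in> path_set a"
  using parity_path unfolding parity_path_def by blast

text \<open>Along upper arcs the chord condition keeps \<open>between a b\<close> constant. Along
  lower arcs the two lower parities \<open>path_parity a x \<noteq> (x < a)\<close> and
  \<open>path_parity b x \<noteq> (x < b)\<close> are constant, and they add up to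
  \<open>upper_side a b x\<close>.\<close>

lemma separates_upper_side:
  assumes "a < N" "b < N" "chord U a b"
  shows "separates (path_set a \<union> path_set b) (upper_side a b)"
proof (rule separatesI)
  fix x y assume xy: "x \<notin> path_set a \<union> path_set b" "y \<notin> path_set a \<union> path_set b"
  then have ne: "x \<notin> {a, b}" "y \<notin> {a, b}"
    using end_in_path_set assms by auto
  show "upper_side a b x = upper_side a b y" if "{x, y} \<in> U"
    using path_parity_simps(1)[OF assms(1), of x y] path_parity_simps(1)[OF assms(2), of x y]
      xy ne that assms(3) unfolding chord_def upper_side_def lower_side_def by auto
  show "upper_side a b x = upper_side a b y" if "{x, y} \<in> D"
    using path_parity_simps(2)[OF assms(1), of x y] path_parity_simps(2)[OF assms(2), of x y]
      xy that unfolding upper_side_def lower_side_def between_def by auto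
next
  fix x assume x: "x \<notin> path_set a \<union> path_set b" "Suc x \<notin> path_set a \<union> path_set b"
  then have ne: "x \<notin> {a, b}" "Suc x \<notin> {a, b}"
    using end_in_path_set assms by auto
  show "upper_side a b x = upper_side a b (Suc x)"
    using path_parity_simps(3)[OF assms(1), of x "Suc x"] path_parity_simps(3)[OF assms(2), of x "Suc x"]
      x ne between_Suc[of x a b] unfolding upper_side_def lower_side_def by auto
qed

lemma separates_lower_side:
  assumes "a < N" "b < N" "chord D a b"
  shows "separates (path_set a \<union> path_set b) (lower_side a b)"
proof (rule separatesI)
  fix x y assume xy: "x \<notin> path_set a \<union> path_set b" "y \<notin> path_set a \<union> path_set b"
  then have ne: "x \<notin> {a, b}" "y \<notin> {a, b}"
    using end_in_path_set assms by auto
  show "lower_side a b x = lower_side a b y" if "{x, y} \<in> U"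
    using path_parity_simps(1)[OF assms(1), of x y] path_parity_simps(1)[OF assms(2), of x y]
      xy that unfolding lower_side_def by auto
  have "between a b x = between a b y" if "{x, y} \<in> D"
    using ne that assms(3) unfolding chord_def by blast
  then show "lower_side a b x = lower_side a b y" if "{x, y} \<in> D"
    using path_parity_simps(2)[OF assms(1), of x y] path_parity_simps(2)[OF assms(2), of x y]
      xy that unfolding lower_side_def between_def by auto
next
  fix x assume x: "x \<notin> path_set a \<union> path_set b" "Suc x \<notin> path_set a \<union> path_set b"
  show "lower_side a b x = lower_side a b (Suc x)"
    using path_parity_simps(3)[OF assms(1), of x "Suc x"] path_parity_simps(3)[OF assms(2), of x "Suc x"]
      x unfolding lower_side_def by auto
qed

lemma chord_Suc: "chord M a (Suc a)"
  unfolding chord_def using between_adjacent by blast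

lemma chord_outer:
  assumes "\<And>x y. {x, y} \<in> M \<Longrightarrow> x < N \<and> y < N"
  shows "chord M 0 (N - 1)"
  unfolding chord_def between_def using assms by fastforce

text \<open>Take for \<open>m\<close> the furthest neighbour of \<open>a\<close> before
  \<open>b\<close>, or \<open>Suc a\<close> if there is none; then \<open>a\<close> and
  \<open>m\<close> are joined by an arc or a segment of the line. An arc blocking the chord from
  \<open>m\<close> to \<open>b\<close> would cross one of the chords \<open>a\<close>,
  \<open>b\<close> and \<open>a\<close>, \<open>m\<close>, or would give \<open>a\<close> a further
  neighbour.\<close>

lemma chord_split:
  assumes M: "non_crossing M" and c: "chord M a b" and ab: "Suc a < b"
  shows "\<exists>m. a < m \<and> m < b \<and> chord M a m \<and> chord M m b"
proof -
  define T where "T = {m. a < m \<and> m < b \<and> {a, m} \<in> M}"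
  have "finite T"
    unfolding T_def by simp
  define m where "m = (if T = {} then Suc a else Max T)"
  have m: "m = Suc a \<or> {a, m} \<in> M" "a < m" "m < b"
    using Max_in[OF \<open>finite T\<close>] ab unfolding m_def by (auto simp: T_def)
  have mx: "y < m" if y: "y < b" "{a, y} \<in> M" "y \<noteq> m" for y
  proof (cases "a < y")
    case True
    then have "y \<in> T"
      using y by (simp add: T_def)
    then have "y \<le> m"
      using Max_ge[OF \<open>finite T\<close>, of y] unfolding m_def by auto
    then show ?thesis
      using y by simp
  qed (use m(2) in simp)
  have am: "chord M a m"
    using m(1) chord_Suc between_cong[OF M] unfolding chord_def by blast
  have "between m b x = between m b y" if xy: "{x, y} \<in> M" "x \<notin> {m, b}" "y \<notin> {m, b}" for x y
  proof -
    have 1: "x \<notin> {a, b} \<Longrightarrow> y \<notin> {a, b} \<Longrightarrow> between a b x = between a b y"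
      using c xy(1) unfolding chord_def by blast
    have 2: "x \<notin> {a, m} \<Longrightarrow> y \<notin> {a, m} \<Longrightarrow> between a m x = between a m y"
      using am xy(1) unfolding chord_def by blast
    have "{y, x} \<in> M"
      using xy(1) by (simp add: insert_commute)
    then show ?thesis
      using 1 2 mx[of x] mx[of y] xy m(2,3) unfolding between_def
      by (cases "x = a"; cases "y = a") auto
  qed
  then have "chord M m b"
    unfolding chord_def by blast
  with am m(2,3) show ?thesis
    by blast
qed

end

text \<open>Each of the three sets misses less than a third of \<open>R\<close>, so their
  complements cannot cover \<open>R\<close>.\<close>

lemma ex_common_of_two_thirds:
  assumes "finite R" "card R \<le> W" "A \<subseteq> R" "B \<subseteq> R" "C \<subseteq> R"
    and "2 * W < 3 * card A" "2 * W < 3 * card B" "2 * W < 3 * card C"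
  shows "\<exists>x. x \<in> A \<and> x \<in> B \<and> x \<in> C"
proof (rule ccontr)
  assume "\<not> ?thesis"
  then have "R \<subseteq> (R - A) \<union> (R - B) \<union> (R - C)"
    by blast
  then have "card R \<le> card ((R - A) \<union> (R - B) \<union> (R - C))"
    using assms(1) by (intro card_mono) auto
  also have "\<dots> \<le> card (R - A) + card (R - B) + card (R - C)"
    by (meson add_le_mono1 card_Un_le order_trans)
  also have "\<dots> = (card R - card A) + (card R - card B) + (card R - card C)"
    using assms(1,3-5) by (metis card_Diff_subset finite_subset)
  moreover have "card A \<le> card R" "card B \<le> card R" "card C \<le> card R"
    using assms(1,3-5) by (auto intro: card_mono)
  ultimately show False
    using assms(2,6-8) by linarith
qed

section \<open>Balanced closed walks and the separator theorem\<close>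

context two_page
begin

text \<open>
  If no closed walk were balanced, each would have a heavy side. Heavy sides add up mod 2 along
  chords \<open>a < m < b\<close>, because three sets of more than two thirds of the weight have a common
  point. Hence the outer chords \<open>0\<close>, \<open>N - 1\<close> drawn above and below the line, which both decompose
  into the segments of the line, would have equal heavy values, although their sides are
  complementary.
\<close>

lemma ex_balanced_side:
  assumes N: "1 < N" and R: "R \<subseteq> {..<N}" "card R \<le> W"
  shows "\<exists>a b f. a < N \<and> b < N \<and> separates (path_set a \<union> path_set b) f \<and>
    (\<forall>v. 3 * card {x \<in> R - (path_set a \<union> path_set b). f x = v} \<le> 2 * W)"
proof (rule ccontr)
  assume no: "\<not> ?thesis"
  have fin: "finite R"
    using R(1) finite_subset by blast
  define heavy where "heavy a b f v \<longleftrightarrow>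
    2 * W < 3 * card {x \<in> R - (path_set a \<union> path_set b). f x = v}" for a b f and v :: bool
  have ex_heavy: "\<exists>v. heavy a b f v" if "a < N" "b < N" "separates (path_set a \<union> path_set b) f" for a b f
    using no that unfolding heavy_def by (meson not_less)
  have common: "\<exists>x. x \<notin> path_set a \<and> x \<notin> path_set m \<and> x \<notin> path_set b \<and> f x = u \<and> g x = v \<and> h x = w"
    if "heavy a m f u" "heavy m b g v" "heavy a b h w" for a m b f g h u v w
    using ex_common_of_two_thirds[OF fin R(2) _ _ _ that[unfolded heavy_def]] by blast
  have "\<exists>v. heavy i (Suc i) (lower_side i (Suc i)) v" if "Suc i < N" for i
    using that by (intro ex_heavy separates_lower_side chord_Suc) auto
  then obtain h where h: "\<And>i. Suc i < N \<Longrightarrow> heavy i (Suc i) (lower_side i (Suc i)) (h i)"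
    by metis
  \<comment> \<open>\<open>K\<close> is a mod 2 primitive of \<open>h\<close>: the heavy values of
    the segments from \<open>a\<close> to \<open>b\<close> sum to
    \<open>K a \<noteq> K b\<close>.\<close>
  define K where "K = rec_nat False (\<lambda>i k. k \<noteq> h i)"
  have K: "K (Suc i) = (K i \<noteq> h i)" for i
    by (simp add: K_def)
  \<comment> \<open>Stated for a general \<open>F\<close> to cover both pages:
    \<open>upper_side\<close> with \<open>U\<close> and \<open>lower_side\<close> with
    \<open>D\<close>. By \<open>F1\<close> the two agree on segments of the line, where the
    induction starts.\<close>
  have sum: "heavy a b (F a b) (K a \<noteq> K b)"
    if M: "non_crossing M"
      and F: "\<And>a b. a < N \<Longrightarrow> b < N \<Longrightarrow> chord M a b \<Longrightarrow> separates (path_set a \<union> path_set b) (F a b)"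
      and F1: "\<And>a x. x \<noteq> a \<Longrightarrow> x \<noteq> Suc a \<Longrightarrow> F a (Suc a) x = lower_side a (Suc a) x"
      and F2: "\<And>a m b x. a < m \<Longrightarrow> m < b \<Longrightarrow> x \<noteq> m \<Longrightarrow> F a b x = (F a m x \<noteq> F m b x)"
      and ab: "a < b" "b < N" "chord M a b"
    for M a b and F :: "nat \<Rightarrow> nat \<Rightarrow> nat \<Rightarrow> bool"
    using ab
  proof (induction "b - a" arbitrary: a b rule: less_induct)
    case less
    show ?case
    proof (cases "b = Suc a")
      case True
      have "{x \<in> R - (path_set a \<union> path_set b). F a b x = v} =
          {x \<in> R - (path_set a \<union> path_set b). lower_side a b x = v}" for v
      proof -
        have "F a b x = lower_side a b x" if "x \<in> R - (path_set a \<union> path_set b)" for x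
          using that F1[of x a] True less.prems end_in_path_set[of a] end_in_path_set[of b] by auto
        then show ?thesis
          by auto
      qed
      moreover have "heavy a b (lower_side a b) (K a \<noteq> K b)"
        using h[of a] K[of a] True less.prems by (cases "K a"; cases "h a") auto
      ultimately show ?thesis
        unfolding heavy_def by simp
    next
      case False
      then obtain m where m: "a < m" "m < b" "chord M a m" "chord M m b"
        using chord_split[OF M less.prems(3)] less.prems(1) by (metis Suc_lessI)
      have 1: "heavy a m (F a m) (K a \<noteq> K m)" "heavy m b (F m b) (K m \<noteq> K b)"
        using less.hyps[of m a] less.hyps[of b m] m less.prems by auto
      obtain v where v: "heavy a b (F a b) v"
        using ex_heavy F less.prems by (metis less_trans)
      obtain x where x: "x \<notin> path_set m" "F a m x = (K a \<noteq> K m)" "F m b x = (K m \<noteq> K b)" "F a b x = v"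
        using common[OF 1 v] by blast
      then have "x \<noteq> m"
        using end_in_path_set[of m] m less.prems by auto
      then have "v = (K a \<noteq> K b)"
        using F2[OF m(1,2), of x] x by argo
      with v show ?thesis
        by simp
    qed
  qed
  let ?n = "N - 1" and ?w = "K 0 \<noteq> K (N - 1)"
  have "heavy 0 ?n (upper_side 0 ?n) ?w"
    using N chord_outer[of U] U_less
    by (intro sum[OF U_nc separates_upper_side])
      (auto simp: upper_side_def lower_side_def between_def)
  moreover have "heavy 0 ?n (lower_side 0 ?n) ?w"
    using N chord_outer[of D] D_less
    by (intro sum[OF D_nc separates_lower_side]) (auto simp: lower_side_def)
  \<comment> \<open>Two heavy sets already meet, so the second is passed twice. Yet the two sides
    differ by \<open>between 0 (N - 1)\<close>, which holds at every vertex except the last, and the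
    last lies on its own path.\<close>
  ultimately obtain x where x: "x \<in> R" "x \<notin> path_set 0" "x \<notin> path_set ?n"
    "upper_side 0 ?n x = lower_side 0 ?n x"
    using ex_common_of_two_thirds[OF fin R(2), of
        "{x \<in> R - (path_set 0 \<union> path_set ?n). upper_side 0 ?n x = ?w}"
        "{x \<in> R - (path_set 0 \<union> path_set ?n). lower_side 0 ?n x = ?w}"
        "{x \<in> R - (path_set 0 \<union> path_set ?n). lower_side 0 ?n x = ?w}"]
    unfolding heavy_def by blast
  then have "x \<noteq> ?n" "x < N"
    using end_in_path_set[of ?n] N R(1) by auto
  then have "between 0 ?n x"
    unfolding between_def by simp
  with x(4) show False
    unfolding upper_side_def by simp
qed

lemma ex_small_fibre:
  fixes L :: "'a \<Rightarrow> nat"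
  assumes "finite V" "card V \<le> r * r" "0 < r"
  shows "\<exists>l. s \<le> l \<and> l < s + r \<and> card {x \<in> V. L x = l} \<le> r"
proof (rule ccontr)
  assume "\<not> ?thesis"
  then have "(\<Sum>l\<in>{s..<s + r}. r) < (\<Sum>l\<in>{s..<s + r}. card {x \<in> V. L x = l})"
    using assms(3) by (intro sum_strict_mono) (auto simp: not_le)
  also have "\<dots> = card (\<Union>l\<in>{s..<s + r}. {x \<in> V. L x = l})"
    using assms(1) by (intro card_UN_disjoint[symmetric]) auto
  also have "\<dots> \<le> card V"
    using assms(1) by (intro card_mono) auto
  finally show False
    using assms(2) by simp
qed

text \<open>The scheme of Lipton and Tarjan. Two thin levels around the median level cut off outer
  parts with at most half of \<open>S\<close> each. The middle part spans fewer than
  \<open>2 * r\<close> levels, and a geodesic has one vertex per level, so a balanced closed walk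
  meets it in at most \<open>4 * r\<close> vertices.\<close>

lemma ex_separator:
  assumes N: "1 < N" "N \<le> r * r" and S: "S \<subseteq> {..<N}"
  shows "\<exists>A X. finite X \<and> card X \<le> 6 * r \<and> separates X (\<lambda>x. x \<in> A) \<and>
    3 * card (A \<inter> S) \<le> 2 * card S \<and> card S \<le> 3 * card (A \<inter> S) + 18 * r"
proof (cases "S = {}")
  case True
  then show ?thesis
    by (intro exI[of _ "{}"]) (auto simp: separates_def)
next
  case False
  define n where "n = card S"
  \<comment> \<open>The shift by \<open>r\<close> makes room for a window of \<open>r\<close> levels
    ending at the median, without truncated subtraction.\<close>
  define L where "L x = level x + r" for x
  have r: "0 < r"
    using N by (cases r) auto
  have fin: "finite S"
    using S finite_subset by blast
  have fin': "finite {x \<in> S. P x}" for P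
    using fin by simp
  have "0 < n"
    using False fin by (simp add: n_def card_gt_0_iff)
  \<comment> \<open>The median level of \<open>S\<close>.\<close>
  define l0 where "l0 = (LEAST l. n \<le> 2 * card {x \<in> S. L x \<le> l})"
  have "{x \<in> S. L x \<le> Max (L ` S)} = S"
    using fin by auto
  then have l0: "n \<le> 2 * card {x \<in> S. L x \<le> l0}"
    unfolding l0_def
    using LeastI[of "\<lambda>l. n \<le> 2 * card {x \<in> S. L x \<le> l}" "Max (L ` S)"] by (simp add: n_def)
  have l0_le: "2 * card {x \<in> S. L x \<le> l} < n" if "l < l0" for l
    using not_less_Least[OF that[unfolded l0_def]] by simp
  have "r \<le> l0"
  proof (rule ccontr)
    assume "\<not> r \<le> l0"
    then have "{x \<in> S. L x \<le> l0} = {}"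
      by (auto simp: L_def)
    then show False
      using l0 \<open>0 < n\<close> by (metis card.empty mult_0_right not_le)
  qed
  \<comment> \<open>By pigeonhole, each window of \<open>r\<close> consecutive levels contains one
    with at most \<open>r\<close> vertices: \<open>l1\<close> comes from the window ending at
    \<open>l0\<close>, \<open>l2\<close> from the one just above.\<close>
  obtain l1 where l1: "l0 + 1 - r \<le> l1" "l1 \<le> l0" "card {x \<in> {..<N}. L x = l1} \<le> r"
    using ex_small_fibre[of "{..<N}" r "l0 + 1 - r" L] r N(2) \<open>r \<le> l0\<close> by auto
  obtain l2 where l2: "l0 < l2" "l2 \<le> l0 + r" "card {x \<in> {..<N}. L x = l2} \<le> r"
    using ex_small_fibre[of "{..<N}" r "l0 + 1" L] r N(2) by (auto simp: Suc_le_eq less_Suc_eq_le)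
  have below: "2 * card {x \<in> S. L x < l1} \<le> n"
  proof (cases l1)
    case (Suc l)
    then show ?thesis
      using l0_le[of l] l1(2) by (simp add: less_Suc_eq_le)
  qed simp
  have above: "2 * card {x \<in> S. l2 < L x} \<le> n"
  proof -
    have "card {x \<in> S. L x \<le> l0} + card {x \<in> S. l2 < L x} = card ({x \<in> S. L x \<le> l0} \<union> {x \<in> S. l2 < L x})"
      using l2(1) fin by (intro card_Un_disjoint[symmetric]) auto
    also have "\<dots> \<le> n"
      unfolding n_def using fin by (intro card_mono) auto
    finally show ?thesis
      using l0 by linarith
  qed
  define mid where "mid = {x. l1 < L x \<and> L x < l2}"
  have "card (S \<inter> mid) \<le> n"
    unfolding n_def using fin by (intro card_mono) auto
  then obtain a b f where ab: "a < N" "b < N" and sep: "separates (path_set a \<union> path_set b) f"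
    and bal: "\<And>v. 3 * card {x \<in> S \<inter> mid - (path_set a \<union> path_set b). f x = v} \<le> 2 * n"
    using ex_balanced_side[of "S \<inter> mid" n] N(1) S by blast
  define X where "X = {x \<in> {..<N}. L x = l1} \<union> {x \<in> {..<N}. L x = l2} \<union>
    ((path_set a \<inter> mid) \<union> (path_set b \<inter> mid))"
  have path_mid: "finite (path_set c \<inter> mid)" "card (path_set c \<inter> mid) \<le> 2 * r" if "c < N" for c
  proof -
    have c: "path_set c \<subseteq> {..<N}" "inj_on level (path_set c)"
      using parity_path[OF that] unfolding parity_path_def by blast+
    show "finite (path_set c \<inter> mid)"
      using c(1) finite_subset by blast
    have "inj_on L (path_set c \<inter> mid)"
      using c(2) unfolding inj_on_def L_def by auto
    then have "card (path_set c \<inter> mid) = card (L ` (path_set c \<inter> mid))"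
      by (simp add: card_image)
    also have "\<dots> \<le> card {l1<..<l2}"
      by (intro card_mono) (auto simp: mid_def)
    finally show "card (path_set c \<inter> mid) \<le> 2 * r"
      using l1(1) l2(2) by simp
  qed
  have finX: "finite X"
    unfolding X_def using path_mid ab by auto
  have "card X \<le> (r + r) + (2 * r + 2 * r)"
    unfolding X_def using path_mid(2) ab l1(3) l2(3)
    by (intro order_trans[OF card_Un_le] add_mono) auto
  then have cardX: "card X \<le> 6 * r"
    by simp
  \<comment> \<open>The parts below \<open>l1\<close> and above \<open>l2\<close>, and the two sides
    of the walk in between. Levels change by at most one along an edge, so outside \<open>X\<close>
    no edge leaves its class.\<close>
  define c where "c x = (if L x < l1 then 0 else if l2 < L x then 1 else if f x then 2 else 3 :: nat)" for x
  have c_edge: "c x = c y" if xy: "(x, y) \<in> edges" "x \<notin> X" "y \<notin> X" for x y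
  proof -
    have "x < N" "y < N"
      using xy(1) by (auto simp: edges_def)
    then have "L x \<noteq> l1" "L x \<noteq> l2" "L y \<noteq> l1" "L y \<noteq> l2"
      using xy(2,3) by (auto simp: X_def)
    moreover have "L x \<le> Suc (L y)" "L y \<le> Suc (L x)"
      using level_edge edges_sym xy(1) by (auto simp: L_def)
    moreover have "f x = f y" if "x \<in> mid" "y \<in> mid"
      using sep xy that unfolding separates_def X_def by blast
    ultimately show ?thesis
      using l1(2) l2(1) unfolding c_def mid_def by auto
  qed
  define p where "p i = card {x \<in> S - X. c x = i}" for i
  have p_le: "3 * p i \<le> 2 * n" for i
  proof -
    have *: "3 * p i \<le> 2 * n" if "{x \<in> S - X. c x = i} \<subseteq> B" "finite B" "3 * card B \<le> 2 * n" for B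
      using card_mono[OF that(2,1)] that(3) by (simp add: p_def)
    consider "i = 0" | "i = 1" | "i = 2" | "i = 3" | "i > 3"
      by linarith
    then show ?thesis
    proof cases
      case 1
      then show ?thesis
        using below fin by (intro *[of "{x \<in> S. L x < l1}"]) (auto simp: c_def split: if_splits)
    next
      case 2
      then show ?thesis
        using above fin by (intro *[of "{x \<in> S. l2 < L x}"]) (auto simp: c_def split: if_splits)
    next
      case 3
      then show ?thesis
        using bal[of True] fin S
        by (intro *[of "{x \<in> S \<inter> mid - (path_set a \<union> path_set b). f x = True}"])
          (auto simp: c_def X_def mid_def split: if_splits)
    next
      case 4
      then show ?thesis
        using bal[of False] fin S
        by (intro *[of "{x \<in> S \<inter> mid - (path_set a \<union> path_set b). f x = False}"])
          (auto simp: c_def X_def mid_def split: if_splits)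
    next
      case 5
      then show ?thesis
        by (intro *[of "{}"]) (auto simp: c_def split: if_splits)
    qed
  qed
  have split: "card {x \<in> S - X. c x \<in> T} = (\<Sum>i\<in>T. p i)" if "finite T" for T
  proof -
    have "{x \<in> S - X. c x \<in> T} = (\<Union>i\<in>T. {x \<in> S - X. c x = i})"
      by auto
    then show ?thesis
      unfolding p_def using that fin by (simp only:) (intro card_UN_disjoint, auto)
  qed
  have "n \<le> card (S - X) + card X"
    unfolding n_def using diff_card_le_card_Diff[OF finX, of S] by linarith
  moreover have "{x \<in> S - X. c x \<in> {0, 1, 2, 3}} = S - X"
    by (auto simp: c_def)
  ultimately have total: "n \<le> p 0 + p 1 + p 2 + p 3 + 6 * r"
    using split[of "{0, 1, 2, 3}"] cardX by simp
  \<comment> \<open>A class with at least a third of \<open>S\<close> is taken alone. Otherwise any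
    two classes hold at most two thirds; applied to classes 2 and 3 this leaves a third, up to the
    \<open>6 * r\<close> points of \<open>X\<close>, for classes 0 and 1.\<close>
  have "\<exists>T. 3 * card {x \<in> S - X. c x \<in> T} \<le> 2 * n \<and> n \<le> 3 * card {x \<in> S - X. c x \<in> T} + 18 * r"
  proof (cases "\<exists>i. n \<le> 3 * p i")
    case True
    then obtain i where "n \<le> 3 * p i"
      by blast
    then show ?thesis
      using p_le[of i] split[of "{i}"] by (intro exI[of _ "{i}"]) simp
  next
    case False
    then have le: "3 * p i \<le> n" for i
      by (meson linear)
    from le[of 0] le[of 1] have "3 * (p 0 + p 1) \<le> 2 * n"
      by simp
    moreover have "n \<le> 3 * (p 0 + p 1) + 18 * r"
      using le[of 2] le[of 3] total by simp
    ultimately show ?thesis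
      using split[of "{0, 1}"] by (intro exI[of _ "{0, 1}"]) simp
  qed
  then obtain T where T: "3 * card {x \<in> S - X. c x \<in> T} \<le> 2 * n"
    "n \<le> 3 * card {x \<in> S - X. c x \<in> T} + 18 * r"
    by blast
  define A where "A = {x. x \<notin> X \<and> c x \<in> T}"
  have "A \<inter> S = {x \<in> S - X. c x \<in> T}"
    by (auto simp: A_def)
  moreover have "separates X (\<lambda>x. x \<in> A)"
    unfolding separates_def A_def using c_edge by fastforce
  ultimately show ?thesis
    using T finX cardX unfolding n_def by (intro exI[of _ A] exI[of _ X]) simp
qed

end

section \<open>Orderings without balanced cuts\<close>

text \<open>The first letter is free; each further letter either agrees with its neighbour, with
  factor 1, or differs, with factor \<open>t\<close>.\<close>

lemma sum_power_changes:
  fixes t :: real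
  shows "(\<Sum>v | length (v :: bool list) = Suc n. t ^ changes v) = 2 * (1 + t) ^ n"
proof (induction n)
  case 0
  have "{v :: bool list. length v = Suc 0} = {[True], [False]}"
    by (auto simp: length_Suc_conv)
  then show ?case
    by simp
next
  case (Suc n)
  let ?V = "{v :: bool list. length v = Suc n}"
  have fin: "finite ?V"
    using finite_lists_length_eq[of "UNIV :: bool set" "Suc n"] by simp
  have V: "{v :: bool list. length v = Suc (Suc n)} = (#) True ` ?V \<union> (#) False ` ?V"
  proof -
    have "v \<in> (#) True ` ?V \<union> (#) False ` ?V" if "length v = Suc (Suc n)" for v :: "bool list"
      using that by (cases v) (auto simp: image_iff)
    then show ?thesis
      by auto
  qed
  have "(\<Sum>v | length (v :: bool list) = Suc (Suc n). t ^ changes v)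
      = (\<Sum>v\<in>(#) True ` ?V. t ^ changes v) + (\<Sum>v\<in>(#) False ` ?V. t ^ changes v)"
    unfolding V using fin by (intro sum.union_disjoint) auto
  also have "\<dots> = (\<Sum>v\<in>?V. t ^ changes (True # v) + t ^ changes (False # v))"
    by (simp add: sum.reindex sum.distrib)
  also have "\<dots> = (\<Sum>v\<in>?V. (1 + t) * t ^ changes v)"
  proof (rule sum.cong)
    fix v assume "v \<in> ?V"
    then have "v \<noteq> []"
      by auto
    then show "t ^ changes (True # v) + t ^ changes (False # v) = (1 + t) * t ^ changes v"
      by (cases "hd v") (simp_all add: changes_Cons algebra_simps)
  qed simp
  also have "\<dots> = 2 * (1 + t) ^ Suc n"
    using Suc.IH by (simp add: sum_distrib_left[symmetric])
  finally show ?case .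
qed

text \<open>Exponential Markov bound: for \<open>t = 1 / T\<close> every counted word has weight at
  least \<open>(1 / T) ^ k\<close> in the generating function.\<close>

lemma card_few_changes:
  fixes T :: real
  assumes "1 \<le> T"
  shows "real (card {v :: bool list. length v = Suc n \<and> changes v \<le> k}) \<le> 2 * (1 + 1 / T) ^ n * T ^ k"
proof -
  let ?V = "{v :: bool list. length v = Suc n}" and ?F = "{v :: bool list. length v = Suc n \<and> changes v \<le> k}"
  have fin: "finite ?V"
    using finite_lists_length_eq[of "UNIV :: bool set" "Suc n"] by simp
  have "real (card ?F) * (1 / T) ^ k = (\<Sum>v\<in>?F. (1 / T) ^ k)"
    by simp
  also have "\<dots> \<le> (\<Sum>v\<in>?F. (1 / T) ^ changes v)"
    using assms by (intro sum_mono power_decreasing) auto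
  also have "\<dots> \<le> (\<Sum>v\<in>?V. (1 / T) ^ changes v)"
    using assms fin by (intro sum_mono2) auto
  also have "\<dots> = 2 * (1 + 1 / T) ^ n"
    by (rule sum_power_changes)
  finally show ?thesis
    using assms by (simp add: power_one_over field_simps)
qed

text \<open>The pattern \<open>map f xs\<close> tells how the two subsequences are merged.\<close>

lemma map_filter_eqD:
  assumes "map f xs = map f ys" "filter f xs = filter f ys"
    "filter (\<lambda>x. \<not> f x) xs = filter (\<lambda>x. \<not> f x) ys"
  shows "xs = ys"
proof -
  have "length xs = length ys"
    using assms(1) map_eq_imp_length_eq by blast
  then show ?thesis
    using assms by (induction xs ys rule: list_induct2) (auto split: if_splits)
qed

lemma card_permutations_with_pattern:
  assumes "finite V"
  shows "card {xs \<in> permutations_of_set V. map f xs = w} \<le>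
    fact (card {x \<in> V. f x}) * fact (card {x \<in> V. \<not> f x})"
proof -
  let ?P = "{xs \<in> permutations_of_set V. map f xs = w}"
  let ?Q = "permutations_of_set {x \<in> V. f x} \<times> permutations_of_set {x \<in> V. \<not> f x}"
  let ?h = "\<lambda>xs. (filter f xs, filter (\<lambda>x. \<not> f x) xs)"
  have "card ?P = card (?h ` ?P)"
    by (rule card_image[symmetric], rule inj_onI) (rule map_filter_eqD[of f], auto)
  also have "\<dots> \<le> card ?Q"
    by (intro card_mono finite_cartesian_product finite_permutations_of_set) (auto simp: permutations_of_set_def)
  also have "\<dots> = fact (card {x \<in> V. f x}) * fact (card {x \<in> V. \<not> f x})"
    using assms by (simp add: card_cartesian_product)
  finally show ?thesis .
qed

text \<open>For \<open>2 * a \<le> n\<close> the bound \<open>(n / a) ^ a \<le> n choose a\<close>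
  applies. The second hypothesis says \<open>m \<le> n - a\<close>, so symmetry settles the other
  case.\<close>

lemma two_power_le_binomial:
  assumes "m \<le> a" "m + a \<le> n"
  shows "2 ^ m \<le> n choose a"
proof -
  have *: "2 ^ m \<le> n choose a" if "m \<le> a" "2 * a \<le> n" for a
  proof (cases "a = 0")
    case False
    have "(2 :: real) ^ m \<le> 2 ^ a"
      using that by (intro power_increasing) auto
    also have "\<dots> \<le> (real n / real a) ^ a"
      using that False by (intro power_mono) (auto simp: field_simps simp flip: of_nat_mult)
    also have "\<dots> \<le> real (n choose a)"
      using that by (intro binomial_ge_n_over_k_pow_k) auto
    finally show ?thesis
      by (metis of_nat_le_iff of_nat_numeral of_nat_power)
  qed (use that in auto)
  show ?thesis
  proof (cases "2 * a \<le> n")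
    case False
    then show ?thesis
      using *[of "n - a"] assms binomial_symmetric[of a n] by simp
  qed (use * assms in auto)
qed

text \<open>Weight \<open>1 / 16\<close> per change. From
  \<open>(17 / 16) ^ 400 \<le> 2 ^ 36\<close> and \<open>16 ^ 2 = 2 ^ 8\<close> the square is at
  most \<open>2 ^ (38 + 44 * q)\<close>, which is less than \<open>2 ^ (50 * q)\<close> from
  \<open>q = 7\<close> on.\<close>

lemma few_changes_bound:
  assumes n: "n = Suc n'" "n < 200 * q + 200" "7 \<le> q"
  shows "(card {v :: bool list. length v = n \<and> changes v \<le> q})\<^sup>2 < 2 ^ (50 * q)"
proof -
  let ?F = "card {v :: bool list. length v = n \<and> changes v \<le> q}"
  have pow: "(2 * a ^ (200 * q + 200) * 16 ^ q)\<^sup>2 = 4 * ((a ^ 400) ^ Suc q * 256 ^ q)" for a :: real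
  proof -
    have "(16 ^ q)\<^sup>2 = (256 :: real) ^ q"
      by (simp add: power2_eq_square flip: power_mult_distrib)
    moreover have "(a ^ (200 * q + 200))\<^sup>2 = (a ^ 400) ^ Suc q"
      by (simp only: power_mult[symmetric]) (simp add: algebra_simps)
    ultimately show ?thesis
      by (simp only: power_mult_distrib) simp
  qed
  have "real ?F \<le> 2 * (17 / 16) ^ n' * 16 ^ q"
    using card_few_changes[of 16 n' q] n(1) by simp
  also have "\<dots> \<le> 2 * (17 / 16) ^ (200 * q + 200) * 16 ^ q"
    using n by (intro mult_right_mono mult_left_mono power_increasing) auto
  finally have "(real ?F)\<^sup>2 \<le> (2 * (17 / 16) ^ (200 * q + 200) * 16 ^ q)\<^sup>2"
    by (rule power_mono) simp
  also have "\<dots> = 4 * (((17 / 16) ^ 400) ^ Suc q * 256 ^ q)"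
    by (rule pow)
  also have "\<dots> \<le> 4 * ((2 ^ 36) ^ Suc q * 256 ^ q)"
  proof (intro mult_left_mono mult_right_mono power_mono)
    \<comment> \<open>Rounding the eighth power up to \<open>13 / 8\<close> keeps the numerals of
      the large power small.\<close>
    have "((17 / 16 :: real) ^ 8) ^ 50 \<le> (13 / 8) ^ 50"
      by (intro power_mono) (auto simp: power_divide)
    also have "\<dots> \<le> 2 ^ 36"
      by (simp add: power_divide)
    finally show "(17 / 16 :: real) ^ 400 \<le> 2 ^ 36"
      by (simp flip: power_mult)
  qed auto
  also have "\<dots> = 2 ^ 2 * ((2 ^ 36) ^ Suc q * (2 ^ 8) ^ q)"
    by simp
  also have "\<dots> = 2 ^ (38 + 44 * q)"
    by (simp only: power_mult[symmetric] power_add[symmetric]) (simp add: algebra_simps)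
  also have "\<dots> < 2 ^ (50 * q)"
    using n(3) by (intro power_strict_increasing) auto
  finally show ?thesis
    by (metis of_nat_less_iff of_nat_numeral of_nat_power)
qed

text \<open>If every order failed, each \<open>ps\<close> would come with a balanced set whose
  indicator words \<open>v\<close> along the identity and \<open>w\<close> along \<open>ps\<close>
  have at most \<open>n div 200\<close> changes. A pair \<open>v\<close>, \<open>w\<close> with
  \<open>a\<close> ones in \<open>v\<close> fits at most \<open>fact a * fact (n - a)\<close>
  orders, that is \<open>fact n\<close> divided by \<open>n choose a\<close>, and there are too few
  pairs to account for all orders.\<close>

lemma ex_expanding_order:
  assumes "1400 \<le> n"
  shows "\<exists>ps. distinct ps \<and> set ps = {..<n} \<and>
    (\<forall>A. A \<subseteq> {..<n} \<longrightarrow> n \<le> 4 * card A \<longrightarrow> 4 * card A \<le> 3 * n \<longrightarrow>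
      n div 200 < changes (map (\<lambda>x. x \<in> A) [0..<n]) + changes (map (\<lambda>x. x \<in> A) ps))"
proof (rule ccontr)
  assume no: "\<not> ?thesis"
  define q where "q = n div 200"
  define F where "F = {v :: bool list. length v = n \<and> changes v \<le> q}"
  define G where "G = {v \<in> F. n \<le> 4 * card {x \<in> {..<n}. v ! x} \<and> 4 * card {x \<in> {..<n}. v ! x} \<le> 3 * n}"
  let ?P = "\<lambda>v w. {ps \<in> permutations_of_set {..<n}. map (\<lambda>x. v ! x) ps = w}"
  have finF: "finite F"
    using finite_lists_length_eq[of "UNIV :: bool set" n] unfolding F_def
    by (rule finite_subset[rotated]) auto
  have "ps \<in> (\<Union>v\<in>G. \<Union>w\<in>F. ?P v w)" if ps: "ps \<in> permutations_of_set {..<n}" for ps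
  proof -
    have dist: "distinct ps" "set ps = {..<n}"
      using ps by (auto simp: permutations_of_set_def)
    obtain A where A: "A \<subseteq> {..<n}" "n \<le> 4 * card A" "4 * card A \<le> 3 * n"
      "changes (map (\<lambda>x. x \<in> A) [0..<n]) + changes (map (\<lambda>x. x \<in> A) ps) \<le> q"
      using no dist unfolding q_def by (meson not_less)
    let ?v = "map (\<lambda>x. x \<in> A) [0..<n]" and ?w = "map (\<lambda>x. x \<in> A) ps"
    have "{x \<in> {..<n}. ?v ! x} = A"
      using A(1) by auto
    then have "?v \<in> G"
      using A unfolding G_def F_def by simp
    moreover have "?w \<in> F"
      using A(4) dist distinct_card[OF dist(1)] unfolding F_def by simp
    moreover have "map (\<lambda>x. ?v ! x) ps = ?w"
      using dist(2) by auto
    ultimately show ?thesis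
      using ps by blast
  qed
  then have "card (permutations_of_set {..<n}) \<le> card (\<Union>v\<in>G. \<Union>w\<in>F. ?P v w)"
    using finF by (intro card_mono) (auto simp: G_def)
  also have "\<dots> \<le> (\<Sum>v\<in>G. \<Sum>w\<in>F. card (?P v w))"
    using finF by (intro order_trans[OF card_UN_le] sum_mono card_UN_le) (auto simp: G_def)
  finally have "2 ^ (50 * q) * fact n \<le> (\<Sum>v\<in>G. \<Sum>w\<in>F. 2 ^ (50 * q) * card (?P v w))"
    by (simp add: sum_distrib_left[symmetric])
  also have "\<dots> \<le> (\<Sum>v\<in>G. \<Sum>w\<in>F. fact n)"
  proof (intro sum_mono)
    fix v w assume "v \<in> G" "w \<in> F"
    define a where "a = card {x \<in> {..<n}. v ! x}"
    have "a \<le> card {..<n}"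
      unfolding a_def by (intro card_mono) auto
    then have "a \<le> n"
      by simp
    have "{x \<in> {..<n}. \<not> v ! x} = {..<n} - {x \<in> {..<n}. v ! x}"
      by auto
    then have a': "card {x \<in> {..<n}. \<not> v ! x} = n - a"
      unfolding a_def by (metis (no_types, lifting) card_Diff_subset card_lessThan finite_Collect_conjI finite_lessThan finite_subset mem_Collect_eq subsetI)
    have "n \<le> 4 * a" "4 * a \<le> 3 * n"
      using \<open>v \<in> G\<close> unfolding G_def a_def by auto
    moreover have "200 * q \<le> n"
      by (simp add: q_def)
    \<comment> \<open>Balance makes both \<open>a\<close> and \<open>n - a\<close> at least a
      quarter of \<open>n\<close>, hence at least \<open>50 * q\<close>.\<close>
    ultimately have "2 ^ (50 * q) \<le> n choose a"
      by (intro two_power_le_binomial) linarith+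
    moreover have "card (?P v w) \<le> fact a * fact (n - a)"
      using card_permutations_with_pattern[of "{..<n}" "\<lambda>x. v ! x" w] a' by (simp add: a_def)
    ultimately have "2 ^ (50 * q) * card (?P v w) \<le> (n choose a) * (fact a * fact (n - a))"
      by (rule mult_le_mono)
    also have "\<dots> = fact n"
      using binomial_fact_lemma[OF \<open>a \<le> n\<close>] by (simp add: mult_ac)
    finally show "2 ^ (50 * q) * card (?P v w) \<le> fact n" .
  qed
  also have "\<dots> = card G * card F * fact n"
    by simp
  also have "\<dots> \<le> card F * card F * fact n"
    using finF by (intro mult_le_mono card_mono) (auto simp: G_def)
  finally have "2 ^ (50 * q) \<le> (card F)\<^sup>2"
    by (simp add: power2_eq_square)
  moreover have "(card F)\<^sup>2 < 2 ^ (50 * q)"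
    unfolding F_def using assms by (intro few_changes_bound[of n "n - 1"]) (auto simp: q_def)
  ultimately show False
    by simp
qed

section \<open>The snake meander\<close>

definition flip :: "nat \<Rightarrow> nat \<Rightarrow> nat \<Rightarrow> nat" where
  "flip m b x = (if even b then x else m - 1 - x)"

text \<open>
  The line meets row \<open>j\<close> of column \<open>i\<close> at its point number \<open>snake m i j\<close>, and the point of the line
  visited by the curve at time \<open>t\<close> is \<open>snake_pos m t\<close>. By the symmetry of the grid \<open>snake_pos m\<close> is
  an involution.
\<close>

definition snake :: "nat \<Rightarrow> nat \<Rightarrow> nat \<Rightarrow> nat" where
  "snake m i j = i * m + flip m i j"

definition snake_pos :: "nat \<Rightarrow> nat \<Rightarrow> nat" where
  "snake_pos m t = snake m (flip m (t div m) (t mod m)) (t div m)"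

lemma flip_less: "x < m \<Longrightarrow> flip m b x < m"
  by (auto simp: flip_def)

lemma flip_flip: "x < m \<Longrightarrow> flip m b (flip m b x) = x"
  by (auto simp: flip_def)

lemma snake_div: "j < m \<Longrightarrow> snake m i j div m = i"
  by (simp add: snake_def flip_less)

lemma snake_mod: "j < m \<Longrightarrow> snake m i j mod m = flip m i j"
  by (simp add: snake_def flip_less)

lemma snake_less:
  assumes "i < m" "j < m"
  shows "snake m i j < m * m"
proof -
  have "snake m i j < Suc i * m"
    using flip_less[OF assms(2)] by (simp add: snake_def)
  also have "\<dots> \<le> m * m"
    using assms(1) by (intro mult_le_mono1) simp
  finally show ?thesis .
qed

lemma div_mod_less_of_less_square:
  fixes t m :: nat
  assumes "t < m * m"
  shows "t div m < m" "t mod m < m"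
  using assms by (cases "m = 0"; simp add: less_mult_imp_div_less)+

lemma snake_pos_snake: "i < m \<Longrightarrow> j < m \<Longrightarrow> snake_pos m (snake m j i) = snake m i j"
  by (simp add: snake_pos_def snake_div snake_mod flip_flip)

lemma snake_pos_rowcol: "k < m \<Longrightarrow> snake_pos m (j * m + k) = snake m (flip m j k) j"
  by (simp add: snake_pos_def)

lemma snake_pos_less: "t < m * m \<Longrightarrow> snake_pos m t < m * m"
  unfolding snake_pos_def by (intro snake_less flip_less div_mod_less_of_less_square)

lemma snake_pos_invol:
  assumes "t < m * m"
  shows "snake_pos m (snake_pos m t) = t"
proof -
  have m: "t div m < m" "t mod m < m"
    using div_mod_less_of_less_square[OF assms] by simp_all
  have "snake_pos m (snake_pos m t) = snake m (t div m) (flip m (t div m) (t mod m))"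
    unfolding snake_pos_def[of m t] using m by (intro snake_pos_snake flip_less)
  also have "\<dots> = t"
    using m by (simp add: snake_def flip_flip)
  finally show ?thesis .
qed

definition snake_list :: "nat \<Rightarrow> nat list" where
  "snake_list m = map (snake_pos m) [0..<m * m]"

lemma length_snake_list: "length (snake_list m) = m * m"
  by (simp add: snake_list_def)

lemma inj_on_snake_pos: "inj_on (snake_pos m) {..<m * m}"
  by (rule inj_on_inverseI[of _ "snake_pos m"]) (simp add: snake_pos_invol)

lemma distinct_snake_list: "distinct (snake_list m)"
  unfolding snake_list_def distinct_map using inj_on_snake_pos by (simp add: atLeast0LessThan)

lemma set_snake_list: "set (snake_list m) = {..<m * m}"
proof -
  have "snake_pos m ` {..<m * m} = {..<m * m}"
    using snake_pos_less inj_on_snake_pos by (intro endo_inj_surj) auto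
  then show ?thesis
    by (simp add: snake_list_def atLeast0LessThan)
qed

section \<open>The two matchings of the grid meander\<close>

text \<open>Two consecutive columns \<open>a\<close> and \<open>a + 1\<close> are joined by concentric arcs at their common end.\<close>

definition rainbow :: "nat \<Rightarrow> nat \<Rightarrow> nat \<Rightarrow> nat \<Rightarrow> bool" where
  "rainbow m a p q \<longleftrightarrow> a * m \<le> p \<and> a * m \<le> q \<and> p < (a + 2) * m \<and> q < (a + 2) * m \<and>
     p + q + 1 = 2 * (a + 1) * m"

lemma rainbow_sym: "rainbow m a p q \<Longrightarrow> rainbow m a q p"
  by (auto simp: rainbow_def)

text \<open>Arcs of one rainbow have a common centre and are nested; different rainbows whose
  indices have equal parity occupy disjoint intervals.\<close>

lemma rainbow_nested:
  assumes "rainbow m a p q" "rainbow m b r s" "even a = even b" "p < r" "r < q" "q < s"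
  shows False
proof -
  consider "a = b" | "a + 2 \<le> b" | "b + 2 \<le> a"
    using assms(3) by (metis Suc_leI add_2_eq_Suc' even_Suc le_neq_implies_less less_linear)
  then show False
  proof cases
    case 2
    then have "(a + 2) * m \<le> b * m"
      by (rule mult_le_mono1)
    then show False
      using assms by (auto simp: rainbow_def)
  next
    case 3
    then have "(b + 2) * m \<le> a * m"
      by (rule mult_le_mono1)
    then show False
      using assms by (auto simp: rainbow_def)
  qed (use assms in \<open>auto simp: rainbow_def\<close>)
qed

text \<open>Adjacent columns run in opposite directions, so their offsets in one row add up to
  \<open>m - 1\<close>, as a rainbow requires. Odd rows are traversed backwards, where the lower
  column is \<open>m - 2 - k\<close>; it has the parity of \<open>k\<close> because \<open>m\<close>
  is even.\<close>

lemma snake_pos_step: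
  assumes "even m" "Suc k < m" "j < m"
  shows "\<exists>a. even a = even k \<and> rainbow m a (snake_pos m (j * m + k)) (snake_pos m (j * m + Suc k))"
proof -
  obtain d where d: "m = j + 1 + d"
    using assms(3) by (metis Suc_eq_plus1 Suc_leI le_Suc_ex)
  have pos: "snake_pos m (j * m + k) = snake m (flip m j k) j"
    "snake_pos m (j * m + Suc k) = snake m (flip m j (Suc k)) j"
    using assms(2) by (intro snake_pos_rowcol; simp)+
  have step: "rainbow m i (snake m i j) (snake m (Suc i) j)" for i
  proof -
    have "m - 1 - j = d"
      using d by simp
    then show ?thesis
      unfolding rainbow_def snake_def flip_def using d by (auto simp: algebra_simps)
  qed
  show ?thesis
  proof (cases "even j")
    case True
    then show ?thesis
      using step[of k] pos by (intro exI[of _ k]) (auto simp: flip_def)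
  next
    case False
    define a where "a = m - 2 - k"
    have a: "m - 1 - k = Suc a" "m - 1 - Suc k = a" "even a = even k"
      using assms(1,2) by (auto simp: a_def)
    then have "rainbow m a (snake_pos m (j * m + k)) (snake_pos m (j * m + Suc k))"
      using step[of a] pos False by (auto simp: flip_def intro: rainbow_sym)
    then show ?thesis
      using a by (intro exI[of _ a]) simp
  qed
qed

text \<open>Rows have even length, so a step at an even time stays inside its row and is an arc of
  an even rainbow.\<close>

lemma non_crossing_even_matching_snake:
  assumes "even m"
  shows "non_crossing (even_matching (snake_list m))"
proof -
  have *: "\<exists>a. even a \<and> rainbow m a p q" if pq: "{p, q} \<in> even_matching (snake_list m)" for p q
  proof -
    obtain t where t: "t < m * m" "even t"
      "{p, q} = {snake_list m ! t, snake_list m ! (Suc t mod (m * m))}"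
      using pq unfolding even_matching_def length_snake_list by blast
    define j k where "j = t div m" and "k = t mod m"
    have tjk: "t = j * m + k" "k < m" "j < m"
      using div_mod_less_of_less_square[OF t(1)] by (simp_all add: j_def k_def)
    have "even k"
      using t(2) tjk(1) assms by auto
    then have k: "Suc k < m"
      using tjk(2) assms by (metis Suc_lessI even_Suc)
    have "Suc j * m \<le> m * m"
      using tjk(3) by (intro mult_le_mono1) simp
    then have "Suc t < m * m"
      using tjk(1) k by simp
    then have "{p, q} = {snake_pos m (j * m + k), snake_pos m (j * m + Suc k)}"
      using t tjk by (simp add: snake_list_def)
    moreover obtain a where a: "even a" "rainbow m a (snake_pos m (j * m + k)) (snake_pos m (j * m + Suc k))"
      using snake_pos_step[OF assms k tjk(3)] \<open>even k\<close> by blast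
    ultimately show ?thesis
      using rainbow_sym[OF a(2)] by (metis doubleton_eq_iff)
  qed
  show ?thesis
    unfolding non_crossing_def
  proof (rule notI, elim exE conjE)
    fix p q r s
    assume "{p, q} \<in> even_matching (snake_list m)" "{r, s} \<in> even_matching (snake_list m)"
      and less: "p < r" "r < q" "q < s"
    then obtain a b where "rainbow m a p q" "rainbow m b r s" "even a = even b"
      using *[of p q] *[of r s] by blast
    then show False
      using less by (rule rainbow_nested)
  qed
qed

text \<open>Besides arcs of odd rainbows there are the turns between rows, which join neighbours on
  the line, and the closing arc between \<open>m - 1\<close> and \<open>0\<close>. The latter spans
  only the first column, which no odd rainbow meets.\<close>

lemma non_crossing_odd_matching_snake:
  assumes "even m"
  shows "non_crossing (odd_matching (snake_list m))"
proof -
  define Q where "Q p q \<longleftrightarrow> (\<exists>a. odd a \<and> rainbow m a p q) \<or> q = Suc p \<or> {p, q} = {0, m - 1}" for p q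
  have *: "Q p q \<or> Q q p" if pq: "{p, q} \<in> odd_matching (snake_list m)" for p q
  proof -
    obtain t where t: "t < m * m" "odd t"
      "{p, q} = {snake_list m ! t, snake_list m ! (Suc t mod (m * m))}"
      using pq unfolding odd_matching_def length_snake_list by blast
    define j k where "j = t div m" and "k = t mod m"
    have tjk: "t = j * m + k" "k < m" "j < m"
      using div_mod_less_of_less_square[OF t(1)] by (simp_all add: j_def k_def)
    have "odd k"
      using t(2) tjk(1) assms by auto
    have jm: "Suc j * m \<le> m * m"
      using tjk(3) by (intro mult_le_mono1) simp
    have pos_t: "snake_list m ! t = snake_pos m (j * m + k)"
      using t(1) tjk(1) by (simp add: snake_list_def)
    consider "Suc k < m" | "k = m - 1" "Suc j < m" | "k = m - 1" "j = m - 1"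
      using tjk by linarith
    then show ?thesis
    proof cases
      case 1
      then have "Suc t < m * m"
        using tjk(1) jm by simp
      then have "{p, q} = {snake_pos m (j * m + k), snake_pos m (j * m + Suc k)}"
        using t tjk by (simp add: snake_list_def)
      then show ?thesis
        using snake_pos_step[OF assms 1 tjk(3)] \<open>odd k\<close> unfolding Q_def
        by (auto simp: doubleton_eq_iff)
    next
      case 2
      have "Suc (Suc j) * m \<le> m * m"
        using 2 by (intro mult_le_mono1) simp
      moreover have St: "Suc t = Suc j * m + 0"
        using tjk 2 by simp
      ultimately have "Suc t < m * m"
        using tjk(2) by simp
      then have "snake_list m ! (Suc t mod (m * m)) = snake_pos m (Suc j * m + 0)"
        using St by (simp add: snake_list_def)
      also have "\<dots> = snake m (flip m (Suc j) 0) (Suc j)"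
        using tjk(2) by (intro snake_pos_rowcol) simp
      finally have "{p, q} = {snake m (flip m j k) j, snake m (flip m (Suc j) 0) (Suc j)}"
        using t(3) pos_t snake_pos_rowcol[OF tjk(2)] by simp
      moreover have "snake m (flip m j k) j = Suc (snake m (flip m (Suc j) 0) (Suc j)) \<or>
          snake m (flip m (Suc j) 0) (Suc j) = Suc (snake m (flip m j k) j)"
        using 2 assms unfolding snake_def flip_def by auto
      ultimately show ?thesis
        unfolding Q_def by (metis doubleton_eq_iff)
    next
      case 3
      have "m * m = (m - 1) * m + m"
        using tjk(2) by (cases m) auto
      then have "Suc t = m * m"
        using tjk 3 by simp
      then have "snake_list m ! (Suc t mod (m * m)) = snake_pos m (0 * m + 0)"
        using tjk(2) by (simp add: snake_list_def)
      also have "\<dots> = 0"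
        using tjk(2) by (subst snake_pos_rowcol) (auto simp: snake_def flip_def)
      finally have "{p, q} = {snake m (flip m j k) j, 0}"
        using t(3) pos_t snake_pos_rowcol[OF tjk(2)] by simp
      moreover have "snake m (flip m j k) j = m - 1"
        using 3 assms tjk unfolding snake_def flip_def by auto
      ultimately show ?thesis
        unfolding Q_def by auto
    qed
  qed
  \<comment> \<open>An arc in a crossing has a vertex strictly below it, which rules out the
    turns.\<close>
  have Q: "p = 0 \<and> q = m - 1 \<or> (\<exists>a. odd a \<and> rainbow m a p q)"
    if "Q p q \<or> Q q p" "Suc p < q" for p q
    using that rainbow_sym[of m _ q p] unfolding Q_def doubleton_eq_iff by auto
  have ge: "m \<le> p" if "odd a" "rainbow m a p q" for a p q
  proof -
    have "1 * m \<le> a * m"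
      using that(1) by (intro mult_le_mono1) (auto intro: Suc_leI odd_pos)
    then show ?thesis
      using that(2) unfolding rainbow_def by linarith
  qed
  show ?thesis
    unfolding non_crossing_def
  proof (rule notI, elim exE conjE)
    fix p q r s
    assume pq: "{p, q} \<in> odd_matching (snake_list m)" and rs: "{r, s} \<in> odd_matching (snake_list m)"
      and less: "p < r" "r < q" "q < s"
    have "p = 0 \<and> q = m - 1 \<or> (\<exists>a. odd a \<and> rainbow m a p q)"
      using *[OF pq] less by (intro Q) auto
    moreover have "r = 0 \<and> s = m - 1 \<or> (\<exists>a. odd a \<and> rainbow m a r s)"
      using *[OF rs] less by (intro Q) auto
    ultimately show False
    proof (elim disjE exE conjE)
      fix a b assume "odd a" "rainbow m a p q" "odd b" "rainbow m b r s"
      then show False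
        using rainbow_nested[OF _ _ _ less] by blast
    next
      fix b assume "q = m - 1" "odd b" "rainbow m b r s"
      then show False
        using ge[of b r s] less by simp
    qed (use less in simp_all)
  qed
qed

lemma cyclic_meandric_snake:
  assumes "even m" "0 < m"
  shows "cyclic_meandric (m * m) (cycle_of_list (snake_list m))"
    and "cycle_notation (m * m) (cycle_of_list (snake_list m)) = snake_list m"
proof -
  show cn: "cycle_notation (m * m) (cycle_of_list (snake_list m)) = snake_list m"
    using assms distinct_snake_list
    by (intro cycle_notation_cycle_of_list) (auto simp: snake_list_def snake_pos_def snake_def flip_def)
  have "cyclic_permutation (m * m) (cycle_of_list (snake_list m))"
    using assms distinct_snake_list set_snake_list
    by (subst cyclic_permutation_iff_cycle_of_list) auto
  then show "cyclic_meandric (m * m) (cycle_of_list (snake_list m))"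
    unfolding cyclic_meandric_def cn
    using assms non_crossing_even_matching_snake non_crossing_odd_matching_snake by simp
qed

section \<open>Realising a given cyclic permutation in the grid\<close>

lemma first_return_snake:
  assumes \<sigma>: "cyclic_permutation n \<sigma>" and m: "even m" "0 < m" "n \<le> m"
  shows "\<exists>S. S \<subseteq> {..<m * m} \<and> card S = n \<and>
    first_return (m * m) (cycle_of_list (snake_list m)) S = \<sigma>"
proof -
  define ps where "ps = cycle_notation n \<sigma>"
  have ps: "length ps = n" "distinct ps" "set ps = {..<n}" "cycle_of_list ps = \<sigma>"
    using cycle_notation_props[OF \<sigma>] by (simp_all add: ps_def)
  have ps_less: "ps ! j < n" if "j < n" for j
    using that ps(1,3) by (metis lessThan_iff nth_mem)
  \<comment> \<open>\<open>s j\<close> is the marked point and \<open>t j\<close> the time at which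
    the curve visits it. One mark per row puts the visits in the order of \<open>j\<close>; one mark
    per used column makes \<open>ps ! j\<close> the rank of \<open>s j\<close>.\<close>
  define s where "s j = snake m (ps ! j) j" for j
  define t where "t j = snake m j (ps ! j)" for j
  have lt: "j < m" "ps ! j < m" if "j < n" for j
    using that ps_less[OF that] m(3) by auto
  have pos_t: "snake_pos m (t j) = s j" if "j < n" for j
    unfolding s_def t_def using lt[OF that] by (intro snake_pos_snake)
  have s_div: "s j div m = ps ! j" if "j < n" for j
    unfolding s_def using lt[OF that] by (simp add: snake_div)
  have s_mono: "s i < s j" if "i < n" "j < n" "ps ! i < ps ! j" for i j
    using that s_div by (metis div_le_mono not_less)
  have s_less: "s i < s j \<longleftrightarrow> ps ! i < ps ! j" if "i < n" "j < n" for i j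
  proof (cases "i = j")
    case False
    then have "ps ! i \<noteq> ps ! j"
      using that ps(1,2) by (simp add: nth_eq_iff_index_eq)
    then show ?thesis
      using s_mono[OF that] s_mono[OF that(2,1)] by linarith
  qed simp
  have inj_s: "inj_on s {..<n}"
    using s_div ps(1,2) by (intro inj_onI) (metis lessThan_iff nth_eq_iff_index_eq)
  define S where "S = s ` {..<n}"
  have S: "S \<subseteq> {..<m * m}" "card S = n"
  proof -
    show "S \<subseteq> {..<m * m}"
      using lt by (auto simp: S_def s_def intro!: snake_less)
    show "card S = n"
      using inj_s by (simp add: S_def card_image)
  qed
  have rank: "rank_in S (s j) = ps ! j" if "j < n" for j
  proof -
    let ?I = "{i. i < n \<and> ps ! i < ps ! j}"
    have "{y \<in> S. y < s j} = s ` ?I"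
      using s_less that by (auto simp: S_def)
    then have "rank_in S (s j) = card ?I"
      unfolding rank_in_def using card_image[OF inj_on_subset[OF inj_s], of ?I] by auto
    also have "\<dots> = card ((!) ps ` ?I)"
      using ps(1,2) by (intro card_image[symmetric] inj_onI) (simp add: nth_eq_iff_index_eq)
    also have "(!) ps ` ?I = {..<ps ! j}"
    proof -
      have "c \<in> (!) ps ` ?I" if "c < ps ! j" for c
      proof -
        have "c \<in> set ps"
          using that ps_less[OF \<open>j < n\<close>] ps(3) by auto
        then show ?thesis
          using that ps(1) by (auto simp: in_set_conv_nth)
      qed
      then show ?thesis
        by auto
    qed
    finally show ?thesis
      by simp
  qed
  have "filter (\<lambda>x. x \<in> S) (snake_list m) = map (snake_pos m) (filter (\<lambda>u. snake_pos m u \<in> S) [0..<m * m])"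
    by (simp add: snake_list_def filter_map comp_def)
  \<comment> \<open>Strictly increasing lists with the same elements coincide, so it suffices to
    know the set of visiting times.\<close>
  also have "filter (\<lambda>u. snake_pos m u \<in> S) [0..<m * m] = map t [0..<n]"
  proof (rule strict_sorted_equal)
    show "sorted_wrt (<) (filter (\<lambda>u. snake_pos m u \<in> S) [0..<m * m])"
      by (intro sorted_wrt_filter) simp
    have "t i < t j" if "i < j" "j < n" for i j
    proof -
      have "t i div m = i" "t j div m = j"
        unfolding t_def using lt[of i] lt[of j] that by (simp_all add: snake_div)
      then show ?thesis
        using that by (metis div_le_mono not_less)
    qed
    then show "sorted_wrt (<) (map t [0..<n])"
      by (auto simp: sorted_wrt_iff_nth_less)
    have "u \<in> t ` {..<n}" if "u < m * m" "snake_pos m u \<in> S" for u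
    proof -
      obtain j where j: "j < n" "snake_pos m u = s j"
        using \<open>snake_pos m u \<in> S\<close> by (auto simp: S_def)
      have "u = snake_pos m (s j)"
        using snake_pos_invol[OF \<open>u < m * m\<close>] j(2) by simp
      also have "\<dots> = t j"
        unfolding s_def t_def using lt[OF j(1)] by (intro snake_pos_snake)
      finally show ?thesis
        using j(1) by blast
    qed
    moreover have "t j < m * m" if "j < n" for j
      unfolding t_def using lt[OF that] by (intro snake_less)
    ultimately show "set (filter (\<lambda>u. snake_pos m u \<in> S) [0..<m * m]) = set (map t [0..<n])"
      using pos_t unfolding set_map set_filter set_upt atLeast0LessThan
      by (intro equalityI subsetI) (auto simp: S_def image_iff)
  qed
  finally have "map (rank_in S) (filter (\<lambda>x. x \<in> S) (snake_list m)) =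
      map (\<lambda>j. rank_in S (snake_pos m (t j))) [0..<n]"
    by simp
  also have "\<dots> = map ((!) ps) [0..<n]"
    using pos_t rank by (intro map_cong) auto
  also have "\<dots> = ps"
    using ps(1) map_nth[of ps] by simp
  finally have "map (rank_in S) (filter (\<lambda>x. x \<in> S) (snake_list m)) = ps" .
  then have "first_return (m * m) (cycle_of_list (snake_list m)) S = \<sigma>"
    unfolding first_return_def cyclic_meandric_snake(2)[OF m(1,2)] using ps(4) by simp
  with S show ?thesis
    by blast
qed

lemma ex_meander:
  assumes "cyclic_permutation n \<sigma>" "0 < n"
  shows "\<exists>N. even N \<and> N \<le> 4 * n\<^sup>2 \<and>
    (\<exists>\<tau> S. cyclic_meandric N \<tau> \<and> S \<subseteq> {..<N} \<and> card S = n \<and> first_return N \<tau> S = \<sigma>)"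
proof -
  \<comment> \<open>\<open>n\<close> rounded up to an even number; it is at most
    \<open>2 * n\<close>, whence the factor 4.\<close>
  define m where "m = n + n mod 2"
  have m: "even m" "0 < m" "n \<le> m" "m \<le> 2 * n"
    using assms(2) by (auto simp: m_def)
  have "m * m \<le> (2 * n) * (2 * n)"
    using m(4) by (intro mult_le_mono)
  then have "even (m * m)" "m * m \<le> 4 * n\<^sup>2"
    using m(1) by (simp_all add: power2_eq_square)
  then show ?thesis
    using cyclic_meandric_snake(1)[OF m(1,2)] first_return_snake[OF assms(1) m(1-3)] by blast
qed

section \<open>The meander number\<close>

lemma matching_subset:
  assumes "{x, y} \<in> even_matching xs \<or> {x, y} \<in> odd_matching xs"
  shows "x \<in> set xs \<and> y \<in> set xs"
proof -
  obtain i where "i < length xs" "{x, y} = {xs ! i, xs ! (Suc i mod length xs)}"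
    using assms unfolding even_matching_def odd_matching_def by blast
  moreover from this(1) have "Suc i mod length xs < length xs"
    by (intro mod_less_divisor) linarith
  ultimately show ?thesis
    by (metis doubleton_eq_iff nth_mem)
qed

text \<open>The counterpart of \<open>first_return\<close> for the line: along it the marked points
  carry the identity order.\<close>

lemma map_rank_in_filter_upt:
  assumes "S \<subseteq> {..<N}"
  shows "map (rank_in S) (filter (\<lambda>x. x \<in> S) [0..<N]) = [0..<card S]"
proof (rule strict_sorted_equal)
  have fin: "finite S"
    using assms finite_subset by blast
  have rank_less: "rank_in S x < rank_in S y" if "x \<in> S" "x < y" for x y
    unfolding rank_in_def using that fin by (intro psubset_card_mono) auto
  have "sorted_wrt (<) (filter (\<lambda>x. x \<in> S) [0..<N])"
    by (intro sorted_wrt_filter) simp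
  then show "sorted_wrt (<) (map (rank_in S) (filter (\<lambda>x. x \<in> S) [0..<N]))"
    unfolding sorted_wrt_map by (rule sorted_wrt_mono_rel[rotated]) (simp add: rank_less)
  show "set (map (rank_in S) (filter (\<lambda>x. x \<in> S) [0..<N])) = set [0..<card S]"
  proof -
    have "set (filter (\<lambda>x. x \<in> S) [0..<N]) = S"
      using assms by auto
    then show ?thesis
      using rank_in_bij_betw[OF fin] by (simp only: set_map bij_betw_def set_upt atLeast0LessThan)
  qed
qed simp

text \<open>Membership in the separated set changes at most \<open>2 * card X\<close> times along
  the line and along the curve, and restricting to marked points keeps this bound. Expansion then
  limits \<open>n\<close>, unless the set is too small, which only happens for small
  \<open>n\<close>.\<close>

lemma meander_lower_bound:
  assumes ps: "distinct ps" "set ps = {..<n}"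
    and expand: "\<And>A. A \<subseteq> {..<n} \<Longrightarrow> n \<le> 4 * card A \<Longrightarrow> 4 * card A \<le> 3 * n \<Longrightarrow>
      n div 200 < changes (map (\<lambda>x. x \<in> A) [0..<n]) + changes (map (\<lambda>x. x \<in> A) ps)"
    and mea: "cyclic_meandric N \<tau>" "S \<subseteq> {..<N}" "card S = n" "first_return N \<tau> S = cycle_of_list ps"
    and r: "N \<le> r * r"
  shows "n \<le> 5000 * r"
proof -
  have N: "1 < N" and cp: "cyclic_permutation N \<tau>"
    using mea(1) unfolding cyclic_meandric_def by (auto elim!: evenE)
  define xs where "xs = cycle_notation N \<tau>"
  have xs: "length xs = N" "distinct xs" "set xs = {..<N}"
    using cycle_notation_props[OF cp] by (simp_all add: xs_def)
  interpret two_page N "even_matching xs" "odd_matching xs"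
    using N mea(1) matching_subset[of _ _ xs] xs(3) unfolding cyclic_meandric_def xs_def[symmetric]
    by unfold_locales auto
  obtain A X where X: "finite X" "card X \<le> 6 * r" "separates X (\<lambda>x. x \<in> A)"
    and A: "3 * card (A \<inter> S) \<le> 2 * n" "n \<le> 3 * card (A \<inter> S) + 18 * r"
    using ex_separator[OF N r mea(2)] mea(3) by auto
  have few: "changes (map (\<lambda>x. x \<in> A) zs) \<le> 12 * r"
    if "\<And>i. Suc i < length zs \<Longrightarrow> (zs ! i, zs ! Suc i) \<in> edges" "distinct zs" for zs
  proof -
    have "changes (map (\<lambda>x. x \<in> A) zs) \<le> 2 * card X"
      using that X(1,3) unfolding separates_def by (intro changes_le_touching) fast+
    then show ?thesis
      using X(2) by simp
  qed
  have line: "changes (map (\<lambda>x. x \<in> A) [0..<N]) \<le> 12 * r"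
    by (rule few) (auto simp: edges_def)
  have curve: "changes (map (\<lambda>x. x \<in> A) xs) \<le> 12 * r"
  proof (rule few)
    fix i assume i: "Suc i < length xs"
    then have "{xs ! i, xs ! Suc i} = {xs ! i, xs ! (Suc i mod length xs)}" "i < length xs"
      by simp_all
    then have "{xs ! i, xs ! Suc i} \<in> even_matching xs \<or> {xs ! i, xs ! Suc i} \<in> odd_matching xs"
      unfolding even_matching_def odd_matching_def by blast
    moreover have "xs ! i < N" "xs ! Suc i < N"
      using i xs(3) by (metis Suc_lessD lessThan_iff nth_mem)+
    ultimately show "(xs ! i, xs ! Suc i) \<in> edges"
      unfolding edges_def by blast
  qed (rule xs(2))
  have fin: "finite S"
    using mea(2) finite_subset by blast
  define A' where "A' = rank_in S ` (A \<inter> S)"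
  have inj: "inj_on (rank_in S) S" and img: "rank_in S ` S = {..<n}"
    using rank_in_bij_betw[OF fin] mea(3) by (auto simp: bij_betw_def)
  have A': "A' \<subseteq> {..<n}" "card A' = card (A \<inter> S)"
    using img inj unfolding A'_def by (auto intro!: card_image inj_on_subset[OF inj])
  have mem: "rank_in S x \<in> A' \<longleftrightarrow> x \<in> A" if "x \<in> S" for x
    using inj that unfolding A'_def inj_on_def by auto
  have restrict: "changes (map (\<lambda>x. x \<in> A') (map (rank_in S) (filter (\<lambda>x. x \<in> S) zs))) \<le>
      changes (map (\<lambda>x. x \<in> A) zs)" for zs
  proof -
    have "map (\<lambda>x. x \<in> A') (map (rank_in S) (filter (\<lambda>x. x \<in> S) zs)) =
        map (\<lambda>x. x \<in> A) (filter (\<lambda>x. x \<in> S) zs)"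
      using mem by simp
    then show ?thesis
      by (simp only: changes_filter)
  qed
  define ys where "ys = map (rank_in S) (filter (\<lambda>x. x \<in> S) xs)"
  have ys: "distinct ys" "set ys = {..<n}" "cycle_of_list ys = cycle_of_list ps"
    using first_return_listing_props[OF cp mea(2)] mea(3,4)
    unfolding ys_def xs_def first_return_def by simp_all
  \<comment> \<open>The first return fixes the listing only up to rotation, which costs one more
    change.\<close>
  obtain k where "ys = rotate k ps"
    using cycle_of_list_eq_imp_rotate[OF ps(1) ys(1)] ps(2) ys(2,3) by auto
  then have ps_changes: "changes (map (\<lambda>x. x \<in> A') ps) \<le> 12 * r + 1"
    using changes_rotate[of "\<lambda>x. x \<in> A'" ps k] restrict[of xs] curve unfolding ys_def by simp
  have id_changes: "changes (map (\<lambda>x. x \<in> A') [0..<n]) \<le> 12 * r"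
    using restrict[of "[0..<N]"] line map_rank_in_filter_upt[OF mea(2)] mea(3) by simp
  have "0 < r"
    using N r by (cases r) auto
  show ?thesis
  proof (cases "n \<le> 4 * card A'")
    case True
    \<comment> \<open>The bounds \<open>12 * r\<close> and \<open>12 * r + 1\<close> are added;
      \<open>4 * card A' \<le> 3 * n\<close> holds since \<open>A'\<close> has at most two thirds of
      the labels.\<close>
    then have "n div 200 < 24 * r + 1"
      using expand[OF A'(1)] A(1) A'(2) ps_changes id_changes by linarith
    then have "n < 200 * (24 * r + 1)"
      by (simp add: div_less_iff_less_mult mult.commute)
    then show ?thesis
      using \<open>0 < r\<close> by simp
  next
    case False
    \<comment> \<open>Fewer than a quarter of the labels in \<open>A'\<close>, against the lower
      bound of the separator, forces \<open>n < 72 * r\<close>.\<close>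
    then show ?thesis
      using A(2) A'(2) by simp
  qed
qed

section \<open>Quadratic bounds for the meander number\<close>

lemma meander_number_props:
  assumes "cyclic_permutation n \<sigma>" "0 < n"
  shows "meander_number n \<sigma> \<le> 4 * n\<^sup>2"
    and "\<exists>\<tau> S. cyclic_meandric (meander_number n \<sigma>) \<tau> \<and> S \<subseteq> {..<meander_number n \<sigma>} \<and>
      card S = n \<and> first_return (meander_number n \<sigma>) \<tau> S = \<sigma>"
proof -
  let ?Q = "\<lambda>N. even N \<and> (\<exists>\<tau> S. cyclic_meandric N \<tau> \<and> S \<subseteq> {..<N} \<and> card S = n \<and> first_return N \<tau> S = \<sigma>)"
  obtain N where N: "?Q N" "N \<le> 4 * n\<^sup>2"
    using ex_meander[OF assms] by blast
  have "meander_number n \<sigma> = (LEAST N. ?Q N)"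
    by (simp add: meander_number_def)
  then show "meander_number n \<sigma> \<le> 4 * n\<^sup>2"
    "\<exists>\<tau> S. cyclic_meandric (meander_number n \<sigma>) \<tau> \<and> S \<subseteq> {..<meander_number n \<sigma>} \<and>
      card S = n \<and> first_return (meander_number n \<sigma>) \<tau> S = \<sigma>"
    using Least_le[of ?Q, OF N(1)] LeastI[of ?Q, OF N(1)] N(2) by simp_all
qed

lemma ex_large_meander_number:
  assumes "0 < n"
  shows "\<exists>\<sigma>. cyclic_permutation n \<sigma> \<and> n\<^sup>2 \<le> 10 ^ 8 * meander_number n \<sigma>"
proof (cases "1400 \<le> n")
  case True
  obtain ps where ps: "distinct ps" "set ps = {..<n}"
    and expand: "\<And>A. A \<subseteq> {..<n} \<Longrightarrow> n \<le> 4 * card A \<Longrightarrow> 4 * card A \<le> 3 * n \<Longrightarrow>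
      n div 200 < changes (map (\<lambda>x. x \<in> A) [0..<n]) + changes (map (\<lambda>x. x \<in> A) ps)"
    using ex_expanding_order[OF True] by blast
  define N where "N = meander_number n (cycle_of_list ps)"
  have cyc: "cyclic_permutation n (cycle_of_list ps)"
    using ps assms cyclic_permutation_iff_cycle_of_list by blast
  obtain \<tau> S where mea: "cyclic_meandric N \<tau>" "S \<subseteq> {..<N}" "card S = n"
    "first_return N \<tau> S = cycle_of_list ps"
    using meander_number_props(2)[OF cyc assms] unfolding N_def by blast
  \<comment> \<open>As \<open>1 \<le> N\<close>, rounding up at most doubles the root; so
    \<open>n\<close> is at most \<open>10000 * sqrt N\<close>, whose square gives
    \<open>10 ^ 8\<close>.\<close>
  define r where "r = nat \<lceil>sqrt (real N)\<rceil>"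
  have "1 \<le> N"
    using mea(1) by (simp add: cyclic_meandric_def)
  then have "1 \<le> sqrt (real N)"
    by simp
  then have r: "sqrt (real N) \<le> real r" "real r \<le> 2 * sqrt (real N)"
    unfolding r_def by linarith+
  have "real N = sqrt (real N) * sqrt (real N)"
    by simp
  also have "\<dots> \<le> real r * real r"
    using r(1) by (intro mult_mono) auto
  finally have "N \<le> r * r"
    by (simp flip: of_nat_mult)
  then have "n \<le> 5000 * r"
    using meander_lower_bound[OF ps expand mea] by blast
  then have "real n \<le> 5000 * real r"
    by linarith
  also have "\<dots> \<le> 10000 * sqrt (real N)"
    using r(2) by simp
  finally have "(real n)\<^sup>2 \<le> (10000 * sqrt (real N))\<^sup>2"
    by (intro power_mono) auto
  also have "\<dots> = real (10 ^ 8 * N)"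
    by (simp add: power_mult_distrib)
  finally have "n\<^sup>2 \<le> 10 ^ 8 * N"
    by (metis of_nat_le_iff of_nat_power)
  then show ?thesis
    using cyc unfolding N_def by blast
next
  case False
  obtain \<sigma> where \<sigma>: "cyclic_permutation n \<sigma>"
    using max_meander_number_wf(2)[OF assms] by blast
  \<comment> \<open>For small \<open>n\<close> any cyclic permutation serves, since the square of
    1400 is below \<open>10 ^ 8\<close>.\<close>
  have "1 \<le> meander_number n \<sigma>"
    using meander_number_props(2)[OF \<sigma> assms] by (auto simp: cyclic_meandric_def)
  moreover have "n\<^sup>2 \<le> 1400\<^sup>2"
    using False by (intro power_mono) auto
  ultimately have "n\<^sup>2 \<le> 10 ^ 8 * meander_number n \<sigma>"
    by simp
  with \<sigma> show ?thesis
    by blast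
qed

theorem corollaryC:
  shows "\<exists>c C :: real. 0 < c \<and> 0 < C \<and>
    (\<forall>n :: nat. 0 < n \<longrightarrow>
      c * (real n)\<^sup>2 \<le> real (max_meander_number n) \<and>
      real (max_meander_number n) \<le> C * (real n)\<^sup>2)"
proof -
  have "1 / 10 ^ 8 * (real n)\<^sup>2 \<le> real (max_meander_number n) \<and>
    real (max_meander_number n) \<le> 4 * (real n)\<^sup>2" if n: "0 < n" for n
  proof
    let ?M = "{meander_number n \<sigma> | \<sigma>. cyclic_permutation n \<sigma>}"
    note wf = max_meander_number_wf[OF n]
    obtain \<sigma> where \<sigma>: "cyclic_permutation n \<sigma>" "n\<^sup>2 \<le> 10 ^ 8 * meander_number n \<sigma>"
      using ex_large_meander_number[OF n] by blast
    then have "meander_number n \<sigma> \<le> max_meander_number n"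
      unfolding max_meander_number_def using wf(1) by (intro Max_ge) auto
    then have "n\<^sup>2 \<le> 10 ^ 8 * max_meander_number n"
      using \<sigma>(2) by (meson mult_le_mono2 order_trans)
    then have "real (n\<^sup>2) \<le> real (10 ^ 8 * max_meander_number n)"
      by (simp only: of_nat_le_iff)
    then show "1 / 10 ^ 8 * (real n)\<^sup>2 \<le> real (max_meander_number n)"
      by simp
    have "max_meander_number n \<in> ?M"
      unfolding max_meander_number_def using wf by (rule Max_in)
    then have "max_meander_number n \<le> 4 * n\<^sup>2"
      using meander_number_props(1)[OF _ n] by auto
    then have "real (max_meander_number n) \<le> real (4 * n\<^sup>2)"
      by (simp only: of_nat_le_iff)
    then show "real (max_meander_number n) \<le> 4 * (real n)\<^sup>2"
      by simp
  qed
  then show ?thesis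
    by (intro exI[of _ "1 / 10 ^ 8"] exI[of _ 4]) simp
qed

end
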